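(* Let $\beta>2$ and let $(X_1,\dots,X_n)$ be a sample of i.i.d. observations generated from a density $\mathsf p^*$ on $[0,1]^d$ satisfying the following assumption: there exist constants $H^*>0$ and $\Lambda>1$ such that $$\mathsf p^*(x)=|\det[\nabla g^*((g^* )^{-1}(x))]|^{-1},\quad x\in[0,1]^d,$$ with $g^*:[0,1]^d\to[0,1]^d$, $g^*\in\mathcal H^{1+\beta}_\Lambda([0,1]^d,H^* )$. Then for any estimate $\widehat{\mathsf p}$ of $\mathsf p^*$, that is, any measurable function of $X_1,\dots,X_n$, $$\sup_{\mathsf p^*}\mathsf E\,\mathrm{JS}(\widehat{\mathsf p},\mathsf p^* )\ge c\,n^{-2\beta/(2\beta+d)},$$ where the supremum is over densities $\mathsf p^*$ satisfying this assumption and the constant $c>0$ depends on $d$ only.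
   Context: For $f:\Omega\to\mathbb R^m$, $\Omega\subset\mathbb R^d$: $\|f\|_{C^s}=\max_{|\boldsymbol\gamma|\le s}\max_{i}\sup_\Omega|D^{\boldsymbol\gamma}f_i|$, and for $0<\delta\le1$, $[f]_\delta=\max_i\sup_{x\ne y}|f_i(x)-f_i(y)|/\min\{1,\|x-y\|\}^\delta$. For $\alpha>0$ write $\alpha=s+\delta$ with $s\ge0$ an integer and $\delta\in(0,1]$; $\|f\|_{\mathcal H^\alpha}=\max\{\|f\|_{C^s},\max_{|\boldsymbol\gamma|=s}[D^{\boldsymbol\gamma}f]_\delta\}$ and $\mathcal H^\alpha(\Omega,H)=\{f\in C^s(\Omega):\|f\|_{\mathcal H^\alpha}\le H\}$, where $C^s(\Omega)$ consists of functions with bounded continuous partial derivatives up to order $s$. For $\Lambda>1$, $\mathcal H^\alpha_\Lambda(\Omega,H)$ is the set of $f\in\mathcal H^\alpha(\Omega,H)$ with $\Lambda^{-2}I_{d\times d}\preceq\nabla f(x)^\top\nabla f(x)\preceq\Lambda^2I_{d\times d}$ for all $x\in\Omega$. The map $g^*$ is understood to be invertible with inverse defined on $[0,1]^d$; $\mathsf p^*$ is then the Lebesgue density of $g^*(Y)$ with $Y$ uniform on $[0,1]^d$. The estimate $\widehat{\mathsf p}$ takes values in probability densities on $[0,1]^d$. $\mathrm{JS}(\mathsf p,\mathsf q)=\frac12\mathrm{KL}(\mathsf p,\frac{\mathsf p+\mathsf q}2)+\frac12\mathrm{KL}(\mathsf q,\frac{\mathsf p+\mathsf q}2)$, where $\mathrm{KL}$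 is the Kullback–Leibler divergence (natural logarithm, Lebesgue measure). *)

theory Defs
  imports "HOL-Probability.Probability"
begin

section \<open>Hoelder classes\<close>

text \<open>
  Partial derivatives are taken within \<open>\<Omega>\<close>, hence they are one-sided at boundary points of the
  closed cube. A list \<open>[i, j, \<dots>]\<close> of coordinates stands for the iterated derivative
  \<open>\<partial>\<^sub>i \<partial>\<^sub>j \<dots>\<close>; the lists of length \<open>k\<close> enumerate the multi-indices of order \<open>k\<close>, with
  repetitions that differ only in the order of differentiation.
\<close>

definition line_section :: "(real^'d) set \<Rightarrow> 'd \<Rightarrow> real^'d \<Rightarrow> real set" where
  "line_section \<Omega> i x = {t. x + t *\<^sub>R axis i 1 \<in> \<Omega>}"

definition partial_differentiable ::
  "(real^'d) set \<Rightarrow> 'd::finite \<Rightarrow> (real^'d \<Rightarrow> real^'m::finite) \<Rightarrow> real^'d \<Rightarrow> bool" where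
  "partial_differentiable \<Omega> i f x \<longleftrightarrow>
     (\<lambda>t. f (x + t *\<^sub>R axis i 1)) differentiable (at 0 within line_section \<Omega> i x)"

definition partial ::
  "(real^'d) set \<Rightarrow> 'd::finite \<Rightarrow> (real^'d \<Rightarrow> real^'m::finite) \<Rightarrow> real^'d \<Rightarrow> real^'m" where
  "partial \<Omega> i f x =
     vector_derivative (\<lambda>t. f (x + t *\<^sub>R axis i 1)) (at 0 within line_section \<Omega> i x)"

primrec iterated_partial ::
  "(real^'d) set \<Rightarrow> 'd::finite list \<Rightarrow> (real^'d \<Rightarrow> real^'m::finite) \<Rightarrow> real^'d \<Rightarrow> real^'m" where
  "iterated_partial \<Omega> [] f = f"
| "iterated_partial \<Omega> (i # \<gamma>) f = partial \<Omega> i (iterated_partial \<Omega> \<gamma> f)"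

definition C_class :: "nat \<Rightarrow> (real^'d::finite) set \<Rightarrow> (real^'d \<Rightarrow> real^'m::finite) set" where
  "C_class s \<Omega> = {f.
     (\<forall>\<gamma> i. \<forall>x\<in>\<Omega>. length \<gamma> < s \<longrightarrow> partial_differentiable \<Omega> i (iterated_partial \<Omega> \<gamma> f) x) \<and>
     (\<forall>\<gamma>. length \<gamma> \<le> s \<longrightarrow>
        continuous_on \<Omega> (iterated_partial \<Omega> \<gamma> f) \<and> bounded (iterated_partial \<Omega> \<gamma> f ` \<Omega>))}"

definition C_norm :: "nat \<Rightarrow> (real^'d::finite) set \<Rightarrow> (real^'d \<Rightarrow> real^'m::finite) \<Rightarrow> ennreal" where
  "C_norm s \<Omega> f =
     (SUP \<gamma>\<in>{\<gamma>. length \<gamma> \<le> s}. SUP i. SUP x\<in>\<Omega>. ennreal \<bar>iterated_partial \<Omega> \<gamma> f x $ i\<bar>)"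

definition holder_seminorm ::
  "real \<Rightarrow> (real^'d::finite) set \<Rightarrow> (real^'d \<Rightarrow> real^'m::finite) \<Rightarrow> ennreal" where
  "holder_seminorm \<delta> \<Omega> f =
     (SUP i. SUP (x, y)\<in>{(x, y). x \<in> \<Omega> \<and> y \<in> \<Omega> \<and> x \<noteq> y}.
        ennreal (\<bar>f x $ i - f y $ i\<bar> / (min 1 (norm (x - y))) powr \<delta>))"

text \<open>
  The decomposition \<open>\<alpha> = s + \<delta>\<close> has \<open>\<delta> \<in> (0, 1]\<close>, so an integer \<open>\<alpha>\<close> gives
  \<open>s = \<alpha> - 1\<close> and \<open>\<delta> = 1\<close>.
\<close>

definition holder_order :: "real \<Rightarrow> nat" where
  "holder_order \<alpha> = nat (\<lceil>\<alpha>\<rceil> - 1)"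

definition holder_exponent :: "real \<Rightarrow> real" where
  "holder_exponent \<alpha> = \<alpha> - real (holder_order \<alpha>)"

lemma holder_decomposition:
  assumes "\<alpha> > 0"
  shows "\<alpha> = real (holder_order \<alpha>) + holder_exponent \<alpha>"
    and "0 < holder_exponent \<alpha>" and "holder_exponent \<alpha> \<le> 1"
proof -
  have "1 \<le> \<lceil>\<alpha>\<rceil>"
    using assms by linarith
  then have "real (holder_order \<alpha>) = of_int \<lceil>\<alpha>\<rceil> - 1"
    unfolding holder_order_def by simp
  then show "\<alpha> = real (holder_order \<alpha>) + holder_exponent \<alpha>"
    and "0 < holder_exponent \<alpha>" and "holder_exponent \<alpha> \<le> 1"
    unfolding holder_exponent_def by linarith+
qed

definition holder_norm ::
  "real \<Rightarrow> (real^'d::finite) set \<Rightarrow> (real^'d \<Rightarrow> real^'m::finite) \<Rightarrow> ennreal" where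
  "holder_norm \<alpha> \<Omega> f = max (C_norm (holder_order \<alpha>) \<Omega> f)
     (SUP \<gamma>\<in>{\<gamma>. length \<gamma> = holder_order \<alpha>}.
        holder_seminorm (holder_exponent \<alpha>) \<Omega> (iterated_partial \<Omega> \<gamma> f))"

definition holder_class ::
  "real \<Rightarrow> (real^'d::finite) set \<Rightarrow> real \<Rightarrow> (real^'d \<Rightarrow> real^'m::finite) set" where
  "holder_class \<alpha> \<Omega> H = {f \<in> C_class (holder_order \<alpha>) \<Omega>. holder_norm \<alpha> \<Omega> f \<le> ennreal H}"

definition loewner_le :: "real^'d^'d \<Rightarrow> real^'d^'d::finite \<Rightarrow> bool" where
  "loewner_le A B \<longleftrightarrow>
     transpose (B - A) = B - A \<and> (\<forall>v. 0 \<le> v \<bullet> ((B - A) *v v))"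

definition regular_holder_class ::
  "real \<Rightarrow> real \<Rightarrow> (real^'d::finite) set \<Rightarrow> real \<Rightarrow> (real^'d \<Rightarrow> real^'m::finite) set" where
  "regular_holder_class \<Lambda> \<alpha> \<Omega> H = {f \<in> holder_class \<alpha> \<Omega> H. \<forall>x\<in>\<Omega>.
     let J = jacobian f (at x within \<Omega>) in
       loewner_le (mat (1 / \<Lambda>\<^sup>2)) (transpose J ** J) \<and>
       loewner_le (transpose J ** J) (mat (\<Lambda>\<^sup>2))}"

section \<open>Densities on the unit cube\<close>

abbreviation unit_cube :: "(real^'d::finite) set" where
  "unit_cube \<equiv> cbox 0 1"

abbreviation cube_measure :: "(real^'d::finite) measure" where
  "cube_measure \<equiv> restrict_space lborel unit_cube"

text \<open>A density on the cube is a function whose values outside the cube are irrelevant.\<close>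

definition prob_density :: "(real^'d::finite \<Rightarrow> real) \<Rightarrow> bool" where
  "prob_density p \<longleftrightarrow>
     p \<in> borel_measurable cube_measure \<and> (\<forall>x\<in>unit_cube. 0 \<le> p x) \<and>
     (\<integral>\<^sup>+ x. ennreal (p x) \<partial>cube_measure) = 1"

definition density_class :: "real \<Rightarrow> real \<Rightarrow> real \<Rightarrow> (real^'d::finite \<Rightarrow> real) set" where
  "density_class \<beta> H \<Lambda> = {p. prob_density p \<and>
     (\<exists>g. bij_betw g unit_cube unit_cube \<and>
          g \<in> regular_holder_class \<Lambda> (1 + \<beta>) unit_cube H \<and>
          (\<forall>x\<in>unit_cube. p x =
             inverse \<bar>det (jacobian g (at (inv_into unit_cube g x) within unit_cube))\<bar>))}"

text \<open>
  The library writes the divergence of \<open>N\<close> from \<open>M\<close> as \<open>KL_divergence b M N\<close>, so the reference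
  measure comes first.
\<close>

definition KL :: "(real^'d::finite \<Rightarrow> real) \<Rightarrow> (real^'d \<Rightarrow> real) \<Rightarrow> real" where
  "KL p q = KL_divergence (exp 1)
     (density cube_measure (\<lambda>x. ennreal (q x))) (density cube_measure (\<lambda>x. ennreal (p x)))"

definition JS :: "(real^'d::finite \<Rightarrow> real) \<Rightarrow> (real^'d \<Rightarrow> real) \<Rightarrow> real" where
  "JS p q = KL p (\<lambda>x. (p x + q x) / 2) / 2 + KL q (\<lambda>x. (p x + q x) / 2) / 2"

section \<open>Estimation from an i.i.d. sample\<close>

definition sample_law :: "nat \<Rightarrow> (real^'d::finite \<Rightarrow> real) \<Rightarrow> (nat \<Rightarrow> real^'d) measure" where
  "sample_law n p = (\<Pi>\<^sub>M k\<in>{..<n}. density cube_measure (\<lambda>x. ennreal (p x)))"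

text \<open>
  Measurability of the density-valued map \<open>X \<mapsto> q X\<close> is joint measurability of
  \<open>(X, x) \<mapsto> q X x\<close>; then \<open>X \<mapsto> JS (q X) p\<close> is measurable.
\<close>

definition density_estimate ::
  "nat \<Rightarrow> ((nat \<Rightarrow> real^'d::finite) \<Rightarrow> real^'d \<Rightarrow> real) \<Rightarrow> bool" where
  "density_estimate n q \<longleftrightarrow>
     (\<lambda>(X, x). q X x) \<in>
       borel_measurable ((\<Pi>\<^sub>M k\<in>{..<n}. cube_measure) \<Otimes>\<^sub>M cube_measure) \<and>
     (\<forall>X\<in>space (\<Pi>\<^sub>M k\<in>{..<n}. cube_measure). prob_density (q X))"

definition JS_risk ::
  "nat \<Rightarrow> ((nat \<Rightarrow> real^'d::finite) \<Rightarrow> real^'d \<Rightarrow> real) \<Rightarrow> (real^'d \<Rightarrow> real) \<Rightarrow> real" where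
  "JS_risk n q p = (\<integral>X. JS (q X) p \<partial>sample_law n p)"

end

theory Submission
  imports Defs "HOL-Computational_Algebra.Polynomial"
begin

text \<open>
  Assouad's method. Divide the cube into \<open>m ^ d\<close> cells with \<open>m\<close> of order \<open>n powr (1 / (2\<beta> + d))\<close>.
  For a set \<open>\<theta>\<close> of cells perturb the identity, inside the cells of \<open>\<theta>\<close> and only in one coordinate
  direction \<open>e\<close>, by a rescaled smooth bump of amplitude \<open>A / m\<close>. The map stays a bijection of each
  cell, its Jacobian determinant is \<open>1\<close> plus \<open>A\<close> times the derivative of the bump in direction \<open>e\<close>,
  and its Hoelder norm stays bounded because \<open>A\<close> is of order \<open>m powr (- \<beta>)\<close>. The density of the
  image of the uniform law on a cell depends only on whether the cell belongs to \<open>\<theta>\<close>, and toggling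
  a cell changes it by order \<open>A\<^sup>2 / m ^ d\<close>, that is order \<open>1 / n\<close>, in chi-square distance, so \<open>n\<close>
  observations cannot decide membership. Each cell therefore contributes order \<open>1 / n\<close> to the risk
  averaged over \<open>\<theta>\<close>, which sums to \<open>m ^ d / n\<close>.
\<close>

section \<open>A smooth bump\<close>

text \<open>The constant \<open>c\<close> is chosen before \<open>\<beta>\<close>, and
  \<open>H\<close> after it. So one smooth bump must serve every \<open>\<beta>\<close>, and only
  quantities free of \<open>\<beta>\<close> may limit the amplitude: the bound
  \<open>bump_bound 1\<close> on first derivatives, which keeps the Jacobian within 1/2 of the
  identity, and the energy of the differentiated bump. Higher derivatives only enlarge
  \<open>H\<close>.

  Moving points along a single axis makes the Jacobian a rank-one perturbation of the identity.
  Invertibility then reduces to monotonicity on lines parallel to \<open>e\<close>, and the change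
  of variables to a one-dimensional substitution. Because the bump vanishes on the walls of its
  cell, grid hyperplanes orthogonal to \<open>e\<close> stay fixed and no point leaves its cell.

  One integral, \<open>gap k\<close>, plays two roles: it is the chi-square distance between
  neighbouring densities, and up to a constant it bounds from below the loss that any estimate
  incurs on one of the two. The second role needs a pointwise bound that tolerates arbitrarily large
  values of the estimate.\<close>

definition flat :: "real poly \<Rightarrow> real \<Rightarrow> real" where
  "flat p t = (if t > 0 then poly p (1 / t) * exp (- (1 / t)) else 0)"

lemma poly_div_exp_tendsto_0:
  fixes p :: "real poly"
  shows "((\<lambda>x. poly p x / exp x) \<longlongrightarrow> 0) at_top"
proof -
  have "((\<lambda>x. \<Sum>i\<le>degree p. coeff p i * (x ^ i / exp x)) \<longlongrightarrow> (\<Sum>i\<le>degree p. coeff p i * 0)) at_top"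
    by (intro tendsto_intros tendsto_power_div_exp_0)
  then show ?thesis
    by (simp add: poly_altdef sum_divide_distrib)
qed

text \<open>With \<open>u = 1 / t\<close> the right-hand limit becomes that of a polynomial over
  \<open>exp u\<close> at infinity; on the left the function is zero.\<close>

lemma flat_tendsto_0: "(flat p \<longlongrightarrow> 0) (at 0)"
proof -
  have "((\<lambda>t. poly p (inverse t) / exp (inverse t)) \<longlongrightarrow> 0) (at_right 0)"
    by (rule filterlim_compose[OF poly_div_exp_tendsto_0 filterlim_inverse_at_top_right])
  then have "(flat p \<longlongrightarrow> 0) (at_right 0)"
    by (rule Lim_transform_eventually)
       (auto simp: eventually_at_filter flat_def exp_minus field_simps)
  moreover have "(flat p \<longlongrightarrow> 0) (at_left 0)"
    by (rule Lim_transform_eventually[OF tendsto_const]) (auto simp: eventually_at_filter flat_def)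
  ultimately show ?thesis
    by (simp add: filterlim_split_at)
qed

text \<open>The chain rule gives \<open>u^2 * (p - p') (u) * exp (- u)\<close> with
  \<open>u = 1 / t\<close>. Keeping the polynomial as a parameter makes the family
  \<open>flat p\<close> closed under differentiation, which is how smoothness is obtained.\<close>

definition flat_step :: "real poly \<Rightarrow> real poly" where
  "flat_step p = [:0, 0, 1:] * (p - pderiv p)"

lemma flat_has_derivative: "(flat p has_real_derivative flat (flat_step p) t) (at t)"
proof -
  consider "t < 0" | "t = 0" | "t > 0" by linarith
  then show ?thesis
  proof cases
    case 1
    have "((\<lambda>_. 0) has_real_derivative 0) (at t)" by simp
    then have "(flat p has_real_derivative 0) (at t)"
      by (rule has_field_derivative_transform_within_open[of _ _ _ "{..<0}"]) (use 1 in \<open>auto simp: flat_def\<close>)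
    with 1 show ?thesis by (simp add: flat_def)
  next
    case 2
    \<comment> \<open>Dividing by \<open>h\<close> multiplies the polynomial by its variable, so the
      difference quotient at 0 is itself a flat function, \<open>flat (pCons 0 p)\<close>.\<close>
    have "((\<lambda>h. flat p h / h) \<longlongrightarrow> 0) (at 0)"
      by (rule Lim_transform_eventually[OF flat_tendsto_0[of "pCons 0 p"]])
         (auto simp: eventually_at_filter flat_def)
    with 2 show ?thesis by (simp add: DERIV_def flat_def)
  next
    case 3
    have "((\<lambda>t. poly p (1 / t) * exp (- (1 / t))) has_real_derivative flat (flat_step p) t) (at t)"
      using 3 by (auto intro!: derivative_eq_intros DERIV_chain2[OF poly_DERIV]
          simp: flat_def flat_step_def field_simps power2_eq_square)
    then show ?thesis
      by (rule has_field_derivative_transform_within_open[of _ _ _ "{0<..}"]) (use 3 in \<open>auto simp: flat_def\<close>)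
  qed
qed

definition flat_deriv :: "nat \<Rightarrow> real \<Rightarrow> real" where
  "flat_deriv k = flat ((flat_step ^^ k) 1)"

lemma flat_deriv_has_derivative:
  "(flat_deriv k has_real_derivative flat_deriv (Suc k) t) (at t)"
  unfolding flat_deriv_def using flat_has_derivative by simp

lemma flat_deriv_eq_0: "t \<le> 0 \<Longrightarrow> flat_deriv k t = 0"
  by (simp add: flat_deriv_def flat_def)

text \<open>
  Leibniz' rule for the \<open>k\<close>-th derivative of \<open>exp (- 1 / t) * exp (- 1 / (1 - t))\<close> on the unit
  interval, extended by zero.
\<close>

definition bump :: "nat \<Rightarrow> real \<Rightarrow> real" where
  "bump k t = (\<Sum>j\<le>k. real (k choose j) * (flat_deriv j t * ((-1) ^ (k - j) * flat_deriv (k - j) (1 - t))))"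

text \<open>The combinatorial step of Leibniz' rule. Here \<open>F i j\<close> stands for the
  \<open>i\<close>-th derivative of one factor times the \<open>j\<close>-th derivative of the
  other; Pascal's rule merges the two shifted sums.\<close>

lemma pascal_sum:
  fixes F :: "nat \<Rightarrow> nat \<Rightarrow> real"
  shows "(\<Sum>j\<le>k. real (k choose j) * (F (Suc j) (k - j) + F j (Suc (k - j))))
    = (\<Sum>j\<le>Suc k. real (Suc k choose j) * F j (Suc k - j))"
proof -
  have "(\<Sum>j\<le>Suc k. real (Suc k choose j) * F j (Suc k - j))
      = F 0 (Suc k) + (\<Sum>j\<le>k. real (Suc k choose Suc j) * F (Suc j) (k - j))"
    by (subst sum.atMost_Suc_shift) simp
  also have "\<dots> = (\<Sum>j\<le>k. real (k choose j) * F (Suc j) (k - j))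
      + (F 0 (Suc k) + (\<Sum>j\<le>k. real (k choose Suc j) * F (Suc j) (Suc k - Suc j)))"
    by (simp add: sum.distrib algebra_simps)
  also have "F 0 (Suc k) + (\<Sum>j\<le>k. real (k choose Suc j) * F (Suc j) (Suc k - Suc j))
      = (\<Sum>j\<le>Suc k. real (k choose j) * F j (Suc k - j))"
    by (subst sum.atMost_Suc_shift) simp
  also have "\<dots> = (\<Sum>j\<le>k. real (k choose j) * F j (Suc (k - j)))"
    by (simp add: Suc_diff_le)
  finally show ?thesis by (simp add: sum.distrib algebra_simps)
qed

lemma bump_has_derivative: "(bump k has_real_derivative bump (Suc k) t) (at t)"
proof -
  define G where "G i t = (-1) ^ i * flat_deriv i (1 - t)" for i t
  have G: "(G i has_real_derivative G (Suc i) t) (at t)" for i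
    unfolding G_def
    by (auto intro!: derivative_eq_intros DERIV_chain2[OF flat_deriv_has_derivative])
  have "((\<lambda>t. \<Sum>j\<le>k. real (k choose j) * (flat_deriv j t * G (k - j) t)) has_real_derivative
      (\<Sum>j\<le>k. real (k choose j) * (flat_deriv (Suc j) t * G (k - j) t + flat_deriv j t * G (Suc (k - j)) t))) (at t)"
    by (auto intro!: derivative_eq_intros flat_deriv_has_derivative G sum.cong simp: algebra_simps)
  also have "(\<Sum>j\<le>k. real (k choose j) * (flat_deriv (Suc j) t * G (k - j) t + flat_deriv j t * G (Suc (k - j)) t))
     = (\<Sum>j\<le>Suc k. real (Suc k choose j) * (flat_deriv j t * G (Suc k - j) t))"
    using pascal_sum[of k "\<lambda>i j. flat_deriv i t * G j t"] by simp
  finally show ?thesis by (simp add: bump_def[abs_def] G_def)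
qed

lemma bump_continuous: "continuous_on S (bump k)"
  using bump_has_derivative by (meson DERIV_continuous_on has_field_derivative_at_within)

lemma bump_eq_0: "\<not> (0 < t \<and> t < 1) \<Longrightarrow> bump k t = 0"
  unfolding bump_def by (intro sum.neutral ballI) (auto simp: not_less flat_deriv_eq_0)

lemma bump_0_pos: "0 < t \<Longrightarrow> t < 1 \<Longrightarrow> 0 < bump 0 t"
  by (simp add: bump_def flat_deriv_def flat_def)

text \<open>Otherwise \<open>bump 0\<close> would be constant, yet it vanishes at 0 and is positive
  at 1/2. This is what makes the energy positive.\<close>

lemma bump_1_nonzero: "\<exists>t. bump (Suc 0) t \<noteq> 0"
proof (rule ccontr)
  assume "\<nexists>t. bump (Suc 0) t \<noteq> 0"
  then have "\<And>t. (bump 0 has_real_derivative 0) (at t)"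
    using bump_has_derivative[of 0] by metis
  then have "bump 0 (1/2) = bump 0 0"
    by (metis DERIV_const_ratio_const DERIV_isconst_all)
  then show False
    using bump_0_pos[of "1/2"] bump_eq_0[of 0 0] by simp
qed

text \<open>Depends on the number of derivatives alone, so \<open>bump_bound 1\<close> is an
  absolute constant. The normalisation to at least 1 keeps all its powers at least 1.\<close>

definition bump_bound :: "nat \<Rightarrow> real" where
  "bump_bound s = (SOME B. B \<ge> 1 \<and> (\<forall>k\<le>s. \<forall>t. \<bar>bump k t\<bar> \<le> B))"

lemma bump_bounded: "\<exists>B. \<forall>t. \<bar>bump k t\<bar> \<le> B"
proof -
  have "bounded (bump k ` {0..1})"
    by (intro compact_imp_bounded compact_continuous_image bump_continuous) simp
  then obtain B where "\<forall>y\<in>bump k ` {0..1}. norm y \<le> B"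
    unfolding bounded_iff by blast
  then have B: "\<And>t. t \<in> {0..1} \<Longrightarrow> \<bar>bump k t\<bar> \<le> B"
    by simp
  have "\<bar>bump k t\<bar> \<le> max B 0" for t
    using B[of t] bump_eq_0[of t k] by (cases "t \<in> {0..1}") auto
  then show ?thesis by blast
qed

lemma
  shows bump_bound_ge_1: "1 \<le> bump_bound s"
    and abs_bump_le: "k \<le> s \<Longrightarrow> \<bar>bump k t\<bar> \<le> bump_bound s"
proof -
  obtain B where B: "\<And>k t. \<bar>bump k t\<bar> \<le> B k"
    using bump_bounded by metis
  have "\<bar>bump k t\<bar> \<le> max 1 (Max (B ` {..s}))" if "k \<le> s" for k t
    using order_trans[OF B[of k t] Max_ge[of "B ` {..s}" "B k"]] that by (simp add: le_max_iff_disj)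
  then have "\<exists>B. B \<ge> 1 \<and> (\<forall>k\<le>s. \<forall>t. \<bar>bump k t\<bar> \<le> B)"
    by (intro exI[of _ "max 1 (Max (B ` {..s}))"]) auto
  from someI_ex[OF this] show "1 \<le> bump_bound s" "k \<le> s \<Longrightarrow> \<bar>bump k t\<bar> \<le> bump_bound s"
    unfolding bump_bound_def by auto
qed

section \<open>Tilings of the cube by bumps\<close>

definition grid :: "nat \<Rightarrow> ('d::finite \<Rightarrow> nat) set" where
  "grid m = {k. \<forall>i. k i < m}"

text \<open>Open cells are pairwise disjoint, and every derivative of the bumps vanishes on the
  walls left out.\<close>

definition cell :: "nat \<Rightarrow> ('d::finite \<Rightarrow> nat) \<Rightarrow> (real^'d) set" where
  "cell m k = {x. \<forall>i. 0 < m * x $ i - k i \<and> m * x $ i - k i < 1}"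

text \<open>With \<open>c\<close> read as a multi-index, this is the derivative of order
  \<open>c\<close> of the product bump on cell \<open>k\<close>, without the chain-rule factor
  \<open>m ^ |c|\<close>. Leaving that factor out makes the bounds independent of
  \<open>m\<close>.\<close>

definition tile :: "nat \<Rightarrow> ('d::finite \<Rightarrow> nat) \<Rightarrow> ('d \<Rightarrow> nat) \<Rightarrow> real^'d \<Rightarrow> real" where
  "tile m c k x = (\<Prod>i\<in>UNIV. bump (c i) (m * x $ i - k i))"

definition field :: "nat \<Rightarrow> ('d::finite \<Rightarrow> nat) set \<Rightarrow> ('d \<Rightarrow> nat) \<Rightarrow> real^'d \<Rightarrow> real" where
  "field m \<theta> c x = (\<Sum>k\<in>\<theta>. tile m c k x)"

lemma grid_eq: "grid m = (UNIV \<rightarrow>\<^sub>E {..<m})"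
  by (auto simp: grid_def PiE_def Pi_def)

lemma finite_grid: "finite (grid m :: ('d::finite \<Rightarrow> nat) set)"
  unfolding grid_eq by (rule finite_PiE) auto

lemma card_grid: "card (grid m :: ('d::finite \<Rightarrow> nat) set) = m ^ CARD('d)"
  unfolding grid_eq by (subst card_PiE) auto

lemma tile_eq_0: "x \<notin> cell m k \<Longrightarrow> tile m c k x = 0"
  unfolding tile_def cell_def by (auto intro!: prod_zero bump_eq_0)

lemma cell_unique:
  assumes "x \<in> cell m k" "x \<in> cell m k'"
  shows "k = k'"
proof
  fix i
  have "0 < m * x $ i - k i" "m * x $ i - k i < 1" "0 < m * x $ i - k' i" "m * x $ i - k' i < 1"
    using assms by (auto simp: cell_def)
  then show "k i = k' i"
    by linarith
qed

lemma open_cell: "open (cell m k)"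
proof -
  have "cell m k = (\<Inter>i\<in>UNIV. {x. 0 < m * x $ i - k i \<and> m * x $ i - k i < 1})"
    by (auto simp: cell_def)
  then show ?thesis
    by (auto intro!: open_INT open_Collect_conj open_Collect_less continuous_intros)
qed

lemma cell_subset:
  assumes "k \<in> grid m"
  shows "cell m k \<subseteq> unit_cube"
proof
  fix x assume x: "x \<in> cell m k"
  have "0 \<le> x $ i \<and> x $ i \<le> 1" for i
  proof -
    have k: "Suc (k i) \<le> m" using assms by (simp add: grid_def Suc_le_eq)
    have "0 < m * x $ i" "m * x $ i < 1 + k i" using x by (auto simp: cell_def dest!: spec[of _ i])
    with k have "0 < m * x $ i" "m * x $ i < m * 1" by linarith+
    then show ?thesis by (simp add: zero_less_mult_iff)
  qed
  then show "x \<in> unit_cube" by (auto simp: mem_box_cart)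
qed

lemma field_in_cell:
  assumes "finite \<theta>" "x \<in> cell m k"
  shows "field m \<theta> c x = (if k \<in> \<theta> then tile m c k x else 0)"
proof -
  have "field m \<theta> c x = (\<Sum>k'\<in>\<theta>. if k' = k then tile m c k x else 0)"
    unfolding field_def using cell_unique[OF assms(2)] by (intro sum.cong) (auto intro: tile_eq_0)
  then show ?thesis using assms by simp
qed

lemma field_not_in_cell:
  assumes "\<And>k. k \<in> \<theta> \<Longrightarrow> x \<notin> cell m k"
  shows "field m \<theta> c x = 0"
  unfolding field_def using assms by (intro sum.neutral) (auto simp: tile_eq_0)

lemma tile_bound:
  fixes c :: "'d::finite \<Rightarrow> nat"
  assumes "\<And>i. c i \<le> s"
  shows "\<bar>tile m c k x\<bar> \<le> bump_bound s ^ CARD('d)"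
proof -
  have "\<bar>tile m c k x\<bar> \<le> (\<Prod>i\<in>(UNIV::'d set). bump_bound s)"
    unfolding tile_def abs_prod by (intro prod_mono) (auto intro: abs_bump_le assms)
  then show ?thesis by simp
qed

text \<open>At any point at most one summand is nonzero, so the number of cells does not enter the
  bound.\<close>

lemma field_bound:
  fixes c :: "'d::finite \<Rightarrow> nat"
  assumes c: "\<And>i. c i \<le> s"
  shows "\<bar>field m \<theta> c x\<bar> \<le> bump_bound s ^ CARD('d)"
proof -
  have 0: "0 \<le> bump_bound s ^ CARD('d)" using bump_bound_ge_1[of s] by simp
  consider "infinite \<theta>" | "\<And>k. k \<in> \<theta> \<Longrightarrow> x \<notin> cell m k" | k where "finite \<theta>" "x \<in> cell m k"
    by blast
  then show ?thesis
  proof cases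
    \<comment> \<open>A sum over an infinite set is 0 by convention.\<close>
    case 1 then show ?thesis using 0 by (simp add: field_def)
  next
    case 2 then show ?thesis using 0 by (simp add: field_not_in_cell)
  next
    case 3 then show ?thesis using 0 tile_bound[of c s, OF c] by (simp add: field_in_cell)
  qed
qed

lemma tile_has_derivative:
  "(tile m c k has_derivative (\<lambda>v. \<Sum>i\<in>UNIV. tile m (c(i := Suc (c i))) k x * (m * v $ i))) (at x)"
proof -
  have comp: "((\<lambda>x. m * x $ i - k i) has_derivative (\<lambda>v. m * v $ i)) (at x)" for i
    by (auto intro!: derivative_eq_intros bounded_linear_imp_has_derivative simp: bounded_linear_vec_nth)
  have 1: "((\<lambda>x. bump (c i) (m * x $ i - k i)) has_derivative
      (\<lambda>v. bump (Suc (c i)) (m * x $ i - k i) * (m * v $ i))) (at x)" for i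
    using has_derivative_compose[OF comp bump_has_derivative[unfolded has_field_derivative_def]] by simp
  have eq: "tile m (c(i := Suc (c i))) k x
      = bump (Suc (c i)) (m * x $ i - k i) * (\<Prod>j\<in>UNIV - {i}. bump (c j) (m * x $ j - k j))" for i
    unfolding tile_def by (subst prod.remove[of _ i]) (auto intro!: prod.cong)
  have "((\<lambda>x. \<Prod>i\<in>UNIV. bump (c i) (m * x $ i - k i)) has_derivative
      (\<lambda>v. \<Sum>i\<in>UNIV. bump (Suc (c i)) (m * x $ i - k i) * (m * v $ i) *
         (\<Prod>j\<in>UNIV - {i}. bump (c j) (m * x $ j - k j)))) (at x)"
    by (rule has_derivative_prod[OF 1])
  also have "(\<lambda>x. \<Prod>i\<in>UNIV. bump (c i) (m * x $ i - k i)) = tile m c k"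
    by (simp add: tile_def fun_eq_iff)
  finally show ?thesis
    by (simp add: eq mult_ac)
qed

lemma field_has_derivative:
  fixes c :: "'d::finite \<Rightarrow> nat"
  shows
  "(field m \<theta> c has_derivative (\<lambda>v. \<Sum>i\<in>UNIV. field m \<theta> (c(i := Suc (c i))) x * (m * v $ i))) (at x)"
proof -
  have "((\<lambda>x. \<Sum>k\<in>\<theta>. tile m c k x) has_derivative
     (\<lambda>v. \<Sum>k\<in>\<theta>. \<Sum>i\<in>UNIV. tile m (c(i := Suc (c i))) k x * (m * v $ i))) (at x)"
    by (intro has_derivative_sum tile_has_derivative)
  also have "(\<lambda>v::real^'d. \<Sum>k\<in>\<theta>. \<Sum>i\<in>UNIV. tile m (c(i := Suc (c i))) k x * (m * v $ i))
      = (\<lambda>v. \<Sum>i\<in>UNIV. field m \<theta> (c(i := Suc (c i))) x * (m * v $ i))"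
    by (subst sum.swap) (simp only: field_def sum_distrib_right)
  also have "(\<lambda>x. \<Sum>k\<in>\<theta>. tile m c k x) = field m \<theta> c"
    by (simp add: field_def fun_eq_iff)
  finally show ?thesis .
qed

lemma field_continuous: "continuous_on S (field m \<theta> c)"
  by (rule has_derivative_continuous_on, rule has_derivative_at_withinI, rule field_has_derivative)

lemma field_derivative_bound:
  fixes c :: "'d::finite \<Rightarrow> nat" and v :: "real^'d"
  assumes c: "\<And>i. Suc (c i) \<le> s"
  shows "\<bar>\<Sum>i\<in>UNIV. field m \<theta> (c(i := Suc (c i))) x * (m * v $ i)\<bar>
    \<le> CARD('d) * bump_bound s ^ CARD('d) * m * norm v"
proof -
  have "\<bar>field m \<theta> (c(i := Suc (c i))) x * (m * v $ i)\<bar> \<le> bump_bound s ^ CARD('d) * (m * norm v)" for i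
  proof -
    have "(c(i := Suc (c i))) j \<le> s" for j
      using c[of i] c[of j] by auto
    then have "\<bar>field m \<theta> (c(i := Suc (c i))) x\<bar> \<le> bump_bound s ^ CARD('d)"
      by (rule field_bound)
    then show ?thesis unfolding abs_mult
      by (intro mult_mono) (use component_le_norm_cart[of v i] bump_bound_ge_1[of s] in auto)
  qed
  then have "\<bar>\<Sum>i\<in>UNIV. field m \<theta> (c(i := Suc (c i))) x * (m * v $ i)\<bar>
      \<le> (\<Sum>i\<in>(UNIV::'d set). bump_bound s ^ CARD('d) * (m * norm v))"
    by (intro order_trans[OF sum_abs] sum_mono)
  then show ?thesis by (simp add: mult_ac)
qed

lemma field_lipschitz:
  fixes c :: "'d::finite \<Rightarrow> nat"
  assumes c: "\<And>i. Suc (c i) \<le> s"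
  shows "\<bar>field m \<theta> c x - field m \<theta> c y\<bar> \<le> CARD('d) * bump_bound s ^ CARD('d) * m * norm (x - y)"
proof -
  have "norm (field m \<theta> c x - field m \<theta> c y) \<le> (CARD('d) * bump_bound s ^ CARD('d) * m) * norm (x - y)"
  proof (rule differentiable_bound[of UNIV])
    show "(field m \<theta> c has_derivative (\<lambda>v. \<Sum>i\<in>UNIV. field m \<theta> (c(i := Suc (c i))) z * (m * v $ i)))
       (at z within UNIV)" for z
      using field_has_derivative[of m \<theta> c z] by simp
    show "onorm (\<lambda>v. \<Sum>i\<in>UNIV. field m \<theta> (c(i := Suc (c i))) z * (m * v $ i))
       \<le> CARD('d) * bump_bound s ^ CARD('d) * m" for z
      by (intro onorm_le) (use field_derivative_bound[OF c] in auto)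
  qed auto
  then show ?thesis by simp
qed

text \<open>The hypotheses amount to \<open>a \<le> K * min 1 r\<close>, and
  \<open>min 1 r \<le> r powr \<delta>\<close> for exponents in (0, 1]. This turns a sup bound and a
  Lipschitz bound into a Hoelder bound.\<close>

lemma le_powr_interpolate:
  fixes a K r \<delta> :: real
  assumes "a \<le> K" "a \<le> K * r" "0 \<le> r" "0 < \<delta>" "\<delta> \<le> 1" "0 \<le> K"
  shows "a \<le> K * r powr \<delta>"
proof (cases "r \<le> 1")
  case True
  have "r powr 1 \<le> r powr \<delta>"
    using assms True by (intro powr_mono') auto
  then have "K * r \<le> K * r powr \<delta>" using assms by (intro mult_left_mono) auto
  with assms show ?thesis by linarith
next
  case False
  then have "1 \<le> r powr \<delta>" using assms by (intro ge_one_powr_ge_zero) auto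
  then have "K * 1 \<le> K * r powr \<delta>" using assms by (intro mult_left_mono) auto
  with assms show ?thesis by linarith
qed

text \<open>Interpolation with \<open>r = m * min 1 (norm (x - y))\<close>. The gain over the
  Lipschitz bound is the factor \<open>m powr \<delta>\<close> in place of \<open>m\<close>, which
  gives the Hoelder norm its exact order in \<open>m\<close>.\<close>

lemma field_holder:
  fixes c :: "'d::finite \<Rightarrow> nat"
  assumes c: "\<And>i. Suc (c i) \<le> s" and \<delta>: "0 < \<delta>" "\<delta> \<le> 1" and m: "0 < m"
  shows "\<bar>field m \<theta> c x - field m \<theta> c y\<bar>
    \<le> 2 * CARD('d) * bump_bound s ^ CARD('d) * m powr \<delta> * (min 1 (norm (x - y))) powr \<delta>"
proof -
  define C where "C = real CARD('d) * bump_bound s ^ CARD('d)"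
  have B: "1 \<le> bump_bound s ^ CARD('d)" using bump_bound_ge_1 by simp
  have C: "bump_bound s ^ CARD('d) \<le> C" "0 \<le> C"
    unfolding C_def using mult_right_mono[of 1 "real CARD('d)" "bump_bound s ^ CARD('d)"] B by auto
  have c': "c i \<le> s" for i using c[of i] by simp
  have le: "\<bar>field m \<theta> c x - field m \<theta> c y\<bar> \<le> 2 * C"
    using field_bound[of c s m \<theta> x, OF c'] field_bound[of c s m \<theta> y, OF c'] C by linarith
  have "\<bar>field m \<theta> c x - field m \<theta> c y\<bar> \<le> 2 * C * (m * min 1 (norm (x - y)))"
  proof (cases "norm (x - y) \<le> 1")
    case True
    have "\<bar>field m \<theta> c x - field m \<theta> c y\<bar> \<le> C * (m * norm (x - y))"
      using field_lipschitz[of c s m \<theta> x y, OF c] by (simp add: C_def mult_ac)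
    also have "\<dots> \<le> 2 * C * (m * norm (x - y))"
      using C by (intro mult_right_mono) auto
    finally show ?thesis using True by (simp add: min_def)
  next
    case False
    \<comment> \<open>At distance above 1 the minimum is 1, and the sup bound suffices because
      \<open>m\<close> is at least 1.\<close>
    have "2 * C * 1 \<le> 2 * C * m" using m C by (intro mult_left_mono) auto
    then show ?thesis using False le by (simp add: min_def)
  qed
  then have "\<bar>field m \<theta> c x - field m \<theta> c y\<bar> \<le> 2 * C * (m * min 1 (norm (x - y))) powr \<delta>"
    using le \<delta> C by (intro le_powr_interpolate) auto
  then show ?thesis by (simp add: C_def powr_mult mult_ac)
qed

section \<open>Hoelder norms of the perturbed identity\<close>

definition id_partial :: "'d::finite list \<Rightarrow> real^'d \<Rightarrow> real^'d" where
  "id_partial \<gamma> x = (case \<gamma> of [] \<Rightarrow> x | [i] \<Rightarrow> axis i 1 | _ \<Rightarrow> 0)"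

text \<open>
  The closed form of \<open>iterated_partial unit_cube \<gamma> (shift m A e \<theta>)\<close> on the cube, where
  \<open>count_list \<gamma>\<close> is the multi-index of \<open>\<gamma>\<close>.
\<close>

definition shift_partial ::
  "nat \<Rightarrow> real \<Rightarrow> 'd::finite \<Rightarrow> ('d \<Rightarrow> nat) set \<Rightarrow> 'd list \<Rightarrow> real^'d \<Rightarrow> real^'d" where
  "shift_partial m A e \<theta> \<gamma> x =
     id_partial \<gamma> x + (A / m * m ^ length \<gamma> * field m \<theta> (count_list \<gamma>) x) *\<^sub>R axis e 1"

text \<open>The factor \<open>1 / m\<close> cancels the chain-rule factor of the first derivatives,
  so these are of order \<open>A\<close>.\<close>

definition shift :: "nat \<Rightarrow> real \<Rightarrow> 'd::finite \<Rightarrow> ('d \<Rightarrow> nat) set \<Rightarrow> real^'d \<Rightarrow> real^'d" where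
  "shift m A e \<theta> x = x + (A / m * field m \<theta> (\<lambda>_. 0) x) *\<^sub>R axis e 1"

lemma shift_eq_partial:
  fixes e :: "'d::finite"
  shows "shift m A e \<theta> = shift_partial m A e \<theta> []"
proof -
  have "count_list [] = (\<lambda>_::'d. 0)"
    by (simp add: fun_eq_iff)
  then show ?thesis
    by (intro ext) (simp add: shift_def shift_partial_def id_partial_def)
qed

text \<open>The section is an interval of length one containing 0, also at points on the faces.
  Hence one-sided derivatives there are uniquely determined.\<close>

lemma line_section_cube:
  fixes x :: "real^'d::finite"
  assumes "x \<in> unit_cube"
  shows "line_section unit_cube i x = {- x $ i..1 - x $ i}"
proof -
  have "x + t *\<^sub>R axis i 1 \<in> unit_cube \<longleftrightarrow> - x $ i \<le> t \<and> t \<le> 1 - x $ i" for t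
  proof
    assume "x + t *\<^sub>R axis i 1 \<in> unit_cube"
    then show "- x $ i \<le> t \<and> t \<le> 1 - x $ i"
      unfolding mem_box_cart by (auto dest!: spec[of _ i] simp: axis_def)
  next
    assume t: "- x $ i \<le> t \<and> t \<le> 1 - x $ i"
    have x: "0 \<le> x $ j \<and> x $ j \<le> 1" for j
      using assms by (simp add: mem_box_cart)
    have "0 \<le> (x + t *\<^sub>R axis i 1) $ j \<and> (x + t *\<^sub>R axis i 1) $ j \<le> 1" for j
      using x[of j] t by (cases "j = i") (auto simp: axis_def)
    then show "x + t *\<^sub>R axis i 1 \<in> unit_cube"
      by (simp only: mem_box_cart zero_index one_index simp_thms)
  qed
  then show ?thesis by (simp only: line_section_def atLeastAtMost_def atLeast_def atMost_def
        Collect_conj_eq[symmetric])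
qed

text \<open>Partial derivatives within the cube are computed from a formula \<open>h\<close> that is
  differentiable across the faces. Separating \<open>f\<close> from \<open>h\<close> is what lets
  the induction on iterated partials run, since these are identified with a closed form only on the
  cube.\<close>

lemma partial_cube:
  assumes x: "x \<in> unit_cube"
    and f: "\<And>y. y \<in> unit_cube \<Longrightarrow> f y = h y"
    and h: "((\<lambda>t. h (x + t *\<^sub>R axis i 1)) has_vector_derivative D) (at 0)"
  shows "partial_differentiable unit_cube i f x" "partial unit_cube i f x = D"
proof -
  have L: "line_section unit_cube i x = {- x $ i..1 - x $ i}"
    by (rule line_section_cube[OF x])
  have 0: "0 \<in> {- x $ i..1 - x $ i}" "- x $ i < 1 - x $ i"
    using x by (auto simp: mem_box_cart)
  have "((\<lambda>t. f (x + t *\<^sub>R axis i 1)) has_vector_derivative D) (at 0 within line_section unit_cube i x)"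
    by (rule has_vector_derivative_transform[OF _ _ has_vector_derivative_at_within[OF h]])
       (use 0 L f in \<open>auto simp: line_section_def\<close>)
  then show "partial_differentiable unit_cube i f x" "partial unit_cube i f x = D"
    unfolding partial_differentiable_def partial_def L
    using 0 by (auto intro: differentiableI_vector vector_derivative_within_closed_interval)
qed

lemma id_partial_has_derivative:
  "((\<lambda>t. id_partial \<gamma> (x + t *\<^sub>R axis i 1)) has_vector_derivative id_partial (i # \<gamma>) x) (at 0)"
  by (cases \<gamma> rule: list.exhaust; cases "tl \<gamma>")
     (auto simp: id_partial_def has_vector_derivative_def intro!: derivative_eq_intros)

lemma count_list_Cons_fun: "count_list (i # \<gamma>) = (count_list \<gamma>)(i := Suc (count_list \<gamma> i))"
  by (auto simp: fun_eq_iff)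

lemma field_partial:
  fixes x :: "real^'d::finite"
  shows "((\<lambda>t. field m \<theta> c (x + t *\<^sub>R axis i 1)) has_real_derivative
     m * field m \<theta> (c(i := Suc (c i))) x) (at 0)"
proof -
  have 1: "((\<lambda>t. x + t *\<^sub>R axis i 1) has_derivative (\<lambda>t. t *\<^sub>R axis i 1)) (at 0)"
    by (auto intro!: derivative_eq_intros)
  have "((\<lambda>t. field m \<theta> c (x + t *\<^sub>R axis i 1)) has_derivative
      (\<lambda>t. \<Sum>j\<in>UNIV. field m \<theta> (c(j := Suc (c j))) x * (m * (t *\<^sub>R axis i 1 :: real^'d) $ j))) (at 0)"
    using has_derivative_compose[OF 1, of "field m \<theta> c"
        "\<lambda>v. \<Sum>j\<in>UNIV. field m \<theta> (c(j := Suc (c j))) x * (m * v $ j)"]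
      field_has_derivative[of m \<theta> c x] by simp
  also have "(\<lambda>t. \<Sum>j\<in>UNIV. field m \<theta> (c(j := Suc (c j))) x * (m * (t *\<^sub>R axis i 1 :: real^'d) $ j))
      = (\<lambda>t. \<Sum>j\<in>UNIV. if j = i then m * field m \<theta> (c(i := Suc (c i))) x * t else 0)"
    by (intro ext sum.cong) (auto simp: axis_def)
  finally show ?thesis
    by (simp add: has_field_derivative_def)
qed

lemma shift_partial_has_derivative:
  "((\<lambda>t. shift_partial m A e \<theta> \<gamma> (x + t *\<^sub>R axis i 1)) has_vector_derivative
     shift_partial m A e \<theta> (i # \<gamma>) x) (at 0)"
  unfolding shift_partial_def count_list_Cons_fun
  by (rule has_vector_derivative_add[OF id_partial_has_derivative])
     (rule has_vector_derivative_eq_rhs,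
       rule has_vector_derivative_scaleR[OF DERIV_cmult[OF field_partial] has_vector_derivative_const],
       simp)

lemma iterated_partial_shift:
  "x \<in> unit_cube \<Longrightarrow>
    iterated_partial unit_cube \<gamma> (shift m A e \<theta>) x = shift_partial m A e \<theta> \<gamma> x"
proof (induction \<gamma> arbitrary: x)
  case Nil
  then show ?case by (simp add: shift_eq_partial)
next
  case (Cons i \<gamma>)
  then show ?case
    using partial_cube(2)[OF Cons.prems Cons.IH shift_partial_has_derivative] by simp
qed

lemma shift_partial_continuous: "continuous_on S (shift_partial m A e \<theta> \<gamma>)"
proof -
  have "continuous_on S (id_partial \<gamma>)"
    by (cases \<gamma> rule: list.exhaust; cases "tl \<gamma>") (auto simp: id_partial_def[abs_def] intro!: continuous_intros)
  then show ?thesis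
    unfolding shift_partial_def[abs_def] by (intro continuous_intros field_continuous)
qed

lemma shift_C_class: "shift m A e \<theta> \<in> C_class s unit_cube"
proof -
  have "partial_differentiable unit_cube i (iterated_partial unit_cube \<gamma> (shift m A e \<theta>)) x"
    if "x \<in> unit_cube" for i \<gamma> x
    by (rule partial_cube(1)[OF that iterated_partial_shift shift_partial_has_derivative])
  moreover have "continuous_on unit_cube (iterated_partial unit_cube \<gamma> (shift m A e \<theta>))" for \<gamma>
    using shift_partial_continuous by (simp add: iterated_partial_shift cong: continuous_on_cong)
  moreover from this have "bounded (iterated_partial unit_cube \<gamma> (shift m A e \<theta>) ` unit_cube)" for \<gamma>
    by (intro compact_imp_bounded compact_continuous_image) auto
  ultimately show ?thesis by (simp add: C_class_def)
qed

text \<open>A derivative of order \<open>l \<le> s\<close> of the displacement is of size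
  \<open>A / m * m ^ l\<close>, and its Hoelder quotient at order \<open>s\<close> costs a further
  \<open>m powr \<delta>\<close>; both are at most of order
  \<open>A * m powr (\<alpha> - 1)\<close>. The leading 1 accounts for the identity. The index
  \<open>Suc s\<close> appears because the Hoelder quotient is controlled by derivatives of order
  \<open>s + 1\<close>.\<close>

lemma shift_holder_class:
  fixes e :: "'d::finite"
  assumes m: "0 < m" and A: "0 \<le> A" and \<alpha>: "2 < \<alpha>" and s: "s = holder_order \<alpha>"
    and H: "1 + 2 * CARD('d) * bump_bound (Suc s) ^ CARD('d) * (A * m powr (\<alpha> - 1)) \<le> H"
  shows "shift m A e \<theta> \<in> holder_class \<alpha> unit_cube H"
proof -
  define \<delta> where "\<delta> = holder_exponent \<alpha>"
  have sd: "\<alpha> = s + \<delta>" "0 < \<delta>" "\<delta> \<le> 1"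
    using holder_decomposition[of \<alpha>] \<alpha> by (auto simp: s \<delta>_def)
  \<comment> \<open>From order 2 on the derivatives of the identity vanish, so the identity does not
    contribute to the Hoelder seminorm.\<close>
  then have "1 < real s" using \<alpha> by linarith
  then have s2: "2 \<le> s" by simp
  define C where "C = bump_bound (Suc s) ^ CARD('d)"
  have C: "1 \<le> C" unfolding C_def using bump_bound_ge_1 by simp
  have mpow: "A / m * m ^ l \<le> A * m powr (\<alpha> - 1)" if "l \<le> s" for l
  proof -
    have "real m ^ l / m = m powr (real l - 1)"
      using m by (simp add: powr_diff powr_realpow)
    also have "\<dots> \<le> m powr (\<alpha> - 1)"
      using m that sd by (intro powr_mono) auto
    finally have "A * (real m ^ l / m) \<le> A * m powr (\<alpha> - 1)" using A by (intro mult_left_mono)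
    then show ?thesis by simp
  qed
  have CH: "1 + C * (A * m powr (\<alpha> - 1)) \<le> H"
  proof -
    have "1 * (C * (A * m powr (\<alpha> - 1))) \<le> (2 * CARD('d)) * (C * (A * m powr (\<alpha> - 1)))"
    proof (intro mult_right_mono)
      have "1 \<le> CARD('d)" by (simp add: Suc_le_eq)
      then show "1 \<le> real (2 * CARD('d))" by linarith
    qed (use A C in auto)
    then show ?thesis using H by (simp add: C_def mult_ac)
  qed
  have sup: "\<bar>iterated_partial unit_cube \<gamma> (shift m A e \<theta>) x $ j\<bar> \<le> H"
    if "length \<gamma> \<le> s" "x \<in> unit_cube" for \<gamma> x j
  proof -
    have "\<bar>id_partial \<gamma> x $ j\<bar> \<le> 1"
      using that(2) by (auto simp: id_partial_def mem_box_cart axis_def abs_le_iff split: list.split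
          intro: order_trans[of _ 0])
    moreover have "\<bar>(A / m * m ^ length \<gamma> * field m \<theta> (count_list \<gamma>) x) * axis e 1 $ j\<bar> \<le> C * (A * m powr (\<alpha> - 1))"
    proof -
      have "count_list \<gamma> i \<le> Suc s" for i
        using count_le_length[of \<gamma> i] that by simp
      then have "\<bar>field m \<theta> (count_list \<gamma>) x\<bar> \<le> C"
        unfolding C_def by (intro field_bound)
      then have "(A / m * m ^ length \<gamma>) * \<bar>field m \<theta> (count_list \<gamma>) x\<bar> \<le> (A * m powr (\<alpha> - 1)) * C"
        by (intro mult_mono mpow that) (use A in auto)
      then show ?thesis
        using A C by (auto simp: abs_mult axis_def mult_ac)
    qed
    ultimately show ?thesis
      using CH unfolding iterated_partial_shift[OF that(2)] shift_partial_def
        vector_add_component vector_scaleR_component real_scaleR_def by linarith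
  qed
  have hoelder: "\<bar>iterated_partial unit_cube \<gamma> (shift m A e \<theta>) x $ j
       - iterated_partial unit_cube \<gamma> (shift m A e \<theta>) y $ j\<bar> / (min 1 (norm (x - y))) powr \<delta> \<le> H"
    if l: "length \<gamma> = s" and xy: "x \<in> unit_cube" "y \<in> unit_cube" "x \<noteq> y" for \<gamma> x y j
  proof -
    have "\<exists>i i' \<gamma>'. \<gamma> = i # i' # \<gamma>'"
      using l s2 by (cases \<gamma> rule: list.exhaust; cases "tl \<gamma>") auto
    then have "id_partial \<gamma> z = 0" for z
      by (auto simp: id_partial_def)
    then have "\<bar>iterated_partial unit_cube \<gamma> (shift m A e \<theta>) x $ j
       - iterated_partial unit_cube \<gamma> (shift m A e \<theta>) y $ j\<bar>
       = A / m * m ^ s * \<bar>field m \<theta> (count_list \<gamma>) x - field m \<theta> (count_list \<gamma>) y\<bar> * axis e 1 $ j"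
    proof -
      have "iterated_partial unit_cube \<gamma> (shift m A e \<theta>) x $ j
          - iterated_partial unit_cube \<gamma> (shift m A e \<theta>) y $ j
          = A / m * m ^ s * (field m \<theta> (count_list \<gamma>) x - field m \<theta> (count_list \<gamma>) y) * axis e 1 $ j"
        using l xy \<open>\<And>z. id_partial \<gamma> z = 0\<close>
        by (simp add: iterated_partial_shift shift_partial_def algebra_simps diff_divide_distrib)
      then show ?thesis using A by (simp add: abs_mult axis_def)
    qed
    also have "\<dots> \<le> A / m * m ^ s * \<bar>field m \<theta> (count_list \<gamma>) x - field m \<theta> (count_list \<gamma>) y\<bar>"
      using A by (auto simp: axis_def)
    also have "\<dots> \<le> A / m * m ^ s * (2 * CARD('d) * C * m powr \<delta> * (min 1 (norm (x - y))) powr \<delta>)"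
      unfolding C_def using A sd m count_le_length[of \<gamma>] l by (intro mult_left_mono field_holder) auto
    also have "\<dots> = 2 * CARD('d) * C * (A * (m ^ s / m * m powr \<delta>)) * (min 1 (norm (x - y))) powr \<delta>"
      by simp
    also have "m ^ s / m * m powr \<delta> = m powr (\<alpha> - 1)"
      using m by (simp add: sd(1) powr_diff powr_add powr_realpow)
    finally have *: "\<bar>iterated_partial unit_cube \<gamma> (shift m A e \<theta>) x $ j
       - iterated_partial unit_cube \<gamma> (shift m A e \<theta>) y $ j\<bar>
       \<le> 2 * CARD('d) * C * (A * m powr (\<alpha> - 1)) * (min 1 (norm (x - y))) powr \<delta>" .
    have "\<bar>iterated_partial unit_cube \<gamma> (shift m A e \<theta>) x $ j
       - iterated_partial unit_cube \<gamma> (shift m A e \<theta>) y $ j\<bar> / (min 1 (norm (x - y))) powr \<delta>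
       \<le> 2 * CARD('d) * C * (A * m powr (\<alpha> - 1))"
    proof -
      have "0 < min 1 (norm (x - y))" using xy by simp
      then have "0 < (min 1 (norm (x - y))) powr \<delta>" by (metis powr_gt_zero less_irrefl)
      with * show ?thesis by (subst pos_divide_le_eq) simp_all
    qed
    then show ?thesis using H by (simp add: C_def mult_ac)
  qed
  have "holder_norm \<alpha> unit_cube (shift m A e \<theta>) \<le> ennreal H"
    unfolding holder_norm_def C_norm_def holder_seminorm_def s[symmetric] \<delta>_def[symmetric]
    by (intro max.boundedI SUP_least) (auto intro!: SUP_least ennreal_leI sup hoelder)
  then show ?thesis
    using shift_C_class by (simp add: holder_class_def)
qed

section \<open>Perturbed densities\<close>

definition insert_coord :: "'d::finite \<Rightarrow> real^'d \<Rightarrow> real \<Rightarrow> real^'d" where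
  "insert_coord e y t = y + (t - y $ e) *\<^sub>R axis e 1"

lemma insert_coord_nth: "insert_coord e y t $ i = (if i = e then t else y $ i)"
  by (simp add: insert_coord_def axis_def)

lemma insert_coord_same [simp]: "insert_coord e y t $ e = t"
  by (simp add: insert_coord_nth)

lemma insert_coord_id: "insert_coord e y (y $ e) = y"
  by (simp add: insert_coord_def)

lemma insert_coord_add: "insert_coord e y (s + t) = insert_coord e y s + t *\<^sub>R axis e 1"
  by (simp add: insert_coord_def algebra_simps)

lemma cube_nth: "x \<in> unit_cube \<longleftrightarrow> (\<forall>i. 0 \<le> x $ i \<and> x $ i \<le> 1)"
  by (simp add: mem_box_cart)

text \<open>The shape of the Jacobian of a shift along \<open>e\<close>: only row \<open>e\<close>
  differs from the identity. The value is Cramer's rule for the identity matrix.\<close>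

lemma det_replace_row:
  fixes w :: "real^'d::finite"
  shows "det (\<chi> i. if i = e then w else axis i 1) = w $ e"
proof -
  have row: "row i (mat 1 :: real^'d^'d) = axis i 1" for i
    by (auto simp: vec_eq_iff row_def mat_def axis_def)
  show ?thesis
    using cramer_lemma_transpose[of e w "mat 1 :: real^'d^'d"] by (simp add: row basis_expansion cong: if_cong)
qed

text \<open>Since the quadratic form of \<open>transpose J ** J\<close> at \<open>v\<close> is the
  squared norm of \<open>J *v v\<close>, Loewner bounds reduce to bounds on how much
  \<open>J\<close> stretches vectors.\<close>

lemma loewner_gramI:
  fixes J :: "real^'d::finite^'d"
  assumes "\<And>v. c * (norm v)\<^sup>2 \<le> (norm (J *v v))\<^sup>2" "\<And>v. (norm (J *v v))\<^sup>2 \<le> C * (norm v)\<^sup>2"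
  shows "loewner_le (mat c) (transpose J ** J)" "loewner_le (transpose J ** J) (mat C)"
proof -
  have sym: "transpose (transpose J ** J) = transpose J ** J"
    by (simp add: matrix_transpose_mul transpose_transpose)
  have tr: "transpose (P - Q) = transpose P - transpose Q" for P Q :: "real^'d^'d"
    by (simp add: transpose_def vec_eq_iff)
  have gram: "v \<bullet> ((transpose J ** J) *v v) = (norm (J *v v))\<^sup>2" for v
  proof -
    have "v \<bullet> ((transpose J ** J) *v v) = ((J *v v) v* J) \<bullet> v"
      by (simp add: matrix_vector_mul_assoc[symmetric] transpose_matrix_vector inner_commute)
    then show ?thesis by (simp add: dot_lmul_matrix power2_norm_eq_inner)
  qed
  have mat: "v \<bullet> (mat r *v v) = r * (norm v)\<^sup>2" for r :: real and v :: "real^'d"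
  proof -
    have "mat r *v v = r *\<^sub>R v"
      by (simp add: vec_eq_iff matrix_vector_mult_def mat_def if_distrib[of "\<lambda>x. x * _"] cong: if_cong)
    then show ?thesis by (simp add: power2_norm_eq_inner)
  qed
  show "loewner_le (mat c) (transpose J ** J)" "loewner_le (transpose J ** J) (mat C)"
    using assms by (auto simp: loewner_le_def sym tr transpose_mat matrix_vector_mult_diff_rdistrib
        inner_diff_right gram mat)
qed

text \<open>The assumption \<open>small\<close> bounds the derivative of the displacement by 1/2 in
  operator norm. It involves only first derivatives of the bump, hence no
  \<open>\<beta>\<close>.\<close>

locale shift_map =
  fixes m :: nat and A :: real and e :: "'d::finite"
  assumes m: "0 < m" and A: "0 \<le> A"
    and small: "CARD('d) * bump_bound 1 ^ CARD('d) * A \<le> 1 / 2"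
begin

abbreviation "\<phi> \<equiv> shift m A e"

text \<open>The derivative at \<open>x\<close> in direction \<open>v\<close> of the scalar
  displacement \<open>A / m * field m \<theta> (\<lambda>_. 0)\<close>, with \<open>m\<close>
  cancelled.\<close>

definition dw :: "('d \<Rightarrow> nat) set \<Rightarrow> real^'d \<Rightarrow> real^'d \<Rightarrow> real" where
  "dw \<theta> x v = (\<Sum>i\<in>UNIV. A * field m \<theta> ((\<lambda>_. 0)(i := 1)) x * v $ i)"

text \<open>Both the derivative of coordinate \<open>e\<close> of the map along \<open>e\<close> and
  its Jacobian determinant.\<close>

definition slope :: "('d \<Rightarrow> nat) set \<Rightarrow> real^'d \<Rightarrow> real" where
  "slope \<theta> x = 1 + A * field m \<theta> ((\<lambda>_. 0)(e := 1)) x"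

definition dens :: "('d \<Rightarrow> nat) set \<Rightarrow> real^'d \<Rightarrow> real" where
  "dens \<theta> x = 1 / slope \<theta> (inv_into unit_cube (\<phi> \<theta>) x)"

lemma shift_has_derivative: "(\<phi> \<theta> has_derivative (\<lambda>v. v + dw \<theta> x v *\<^sub>R axis e 1)) (at x within S)"
proof -
  have "((\<lambda>x. A / m * field m \<theta> (\<lambda>_. 0) x) has_derivative
     (\<lambda>v. A / m * (\<Sum>i\<in>UNIV. field m \<theta> ((\<lambda>_. 0)(i := Suc 0)) x * (m * v $ i)))) (at x within S)"
    by (intro has_derivative_mult_right has_derivative_at_withinI[OF field_has_derivative])
  also have "(\<lambda>v. A / m * (\<Sum>i\<in>UNIV. field m \<theta> ((\<lambda>_. 0)(i := Suc 0)) x * (m * v $ i))) = dw \<theta> x"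
    using m by (simp add: dw_def fun_eq_iff sum_distrib_left mult_ac)
  finally show ?thesis
    unfolding shift_def by (intro derivative_intros)
qed

lemma abs_dw_le: "\<bar>dw \<theta> x v\<bar> \<le> norm v / 2"
proof -
  have "\<bar>\<Sum>i\<in>UNIV. field m \<theta> ((\<lambda>_. 0)(i := Suc 0)) x * (m * v $ i)\<bar>
      \<le> CARD('d) * bump_bound 1 ^ CARD('d) * m * norm v"
    using field_derivative_bound[of "\<lambda>_. 0" 1 m \<theta> x v] by simp
  then have "A / m * \<bar>\<Sum>i\<in>UNIV. field m \<theta> ((\<lambda>_. 0)(i := Suc 0)) x * (m * v $ i)\<bar>
      \<le> A / m * (CARD('d) * bump_bound 1 ^ CARD('d) * m * norm v)"
    using A by (intro mult_left_mono) auto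
  also have "\<dots> = (CARD('d) * bump_bound 1 ^ CARD('d) * A) * norm v"
    using m by simp
  also have "\<dots> \<le> 1 / 2 * norm v"
    using small by (intro mult_right_mono) auto
  also have "A / m * \<bar>\<Sum>i\<in>UNIV. field m \<theta> ((\<lambda>_. 0)(i := Suc 0)) x * (m * v $ i)\<bar>
      = \<bar>A / m * (\<Sum>i\<in>UNIV. field m \<theta> ((\<lambda>_. 0)(i := Suc 0)) x * (m * v $ i))\<bar>"
    using A by (simp add: abs_mult)
  also have "A / m * (\<Sum>i\<in>UNIV. field m \<theta> ((\<lambda>_. 0)(i := Suc 0)) x * (m * v $ i)) = dw \<theta> x v"
    using m by (simp add: dw_def sum_distrib_left mult_ac)
  finally show ?thesis by simp
qed

lemma slope_eq_dw: "slope \<theta> x = 1 + dw \<theta> x (axis e 1)"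
  by (simp add: slope_def dw_def axis_def if_distrib[of "\<lambda>x. _ * x"] cong: if_cong)

lemma slope_bounds: "1 / 2 \<le> slope \<theta> x" "slope \<theta> x \<le> 3 / 2"
  using abs_dw_le[of \<theta> x "axis e 1"] by (auto simp: slope_eq_dw)

lemma jacobian_shift:
  assumes "x \<in> unit_cube"
  shows "jacobian (\<phi> \<theta>) (at x within unit_cube) = matrix (\<lambda>v. v + dw \<theta> x v *\<^sub>R axis e 1)"
  unfolding jacobian_def
  by (subst frechet_derivative_within_cbox[OF _ assms shift_has_derivative])
     (auto simp: Basis_vec_def inner_axis)

lemma linear_deriv: "linear (\<lambda>v. v + dw \<theta> x v *\<^sub>R axis e 1)"
  using shift_has_derivative[of \<theta> x UNIV] by (rule has_derivative_linear)

lemma det_jacobian_shift: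
  assumes "x \<in> unit_cube"
  shows "det (jacobian (\<phi> \<theta>) (at x within unit_cube)) = slope \<theta> x"
proof -
  have "matrix (\<lambda>v. v + dw \<theta> x v *\<^sub>R axis e 1)
     = (\<chi> i. if i = e then (\<chi> j. axis j 1 $ e + dw \<theta> x (axis j 1)) else axis i 1)"
    by (auto simp: matrix_def vec_eq_iff axis_def)
  then show ?thesis
    by (simp add: jacobian_shift[OF assms] det_replace_row slope_eq_dw axis_def)
qed

text \<open>This is why \<open>\<Lambda> = 2\<close> works for all \<open>\<beta>\<close>: a
  displacement derivative of norm at most 1/2 leaves the length of \<open>v\<close> multiplied by a
  factor between 1/2 and 3/2.\<close>

lemma shift_loewner:
  fixes \<theta> x
  assumes "x \<in> unit_cube"
  defines "J \<equiv> jacobian (\<phi> \<theta>) (at x within unit_cube)"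
  shows "loewner_le (mat (1 / 2\<^sup>2)) (transpose J ** J)" "loewner_le (transpose J ** J) (mat (2\<^sup>2))"
proof -
  have J: "J *v v = v + dw \<theta> x v *\<^sub>R axis e 1" for v
    unfolding J_def jacobian_shift[OF assms(1)] by (simp add: matrix_works linear_deriv)
  have dw: "norm (dw \<theta> x v *\<^sub>R axis e 1 :: real^'d) \<le> norm v / 2" for v
    using abs_dw_le[of \<theta> x v] by simp
  have N: "norm v / 2 \<le> norm (J *v v)" "norm (J *v v) \<le> 2 * norm v" for v
    unfolding J using norm_triangle_ineq[of v "dw \<theta> x v *\<^sub>R axis e 1"]
      norm_diff_ineq[of v "dw \<theta> x v *\<^sub>R axis e 1"] dw[of v] norm_ge_zero[of v] by linarith+
  have "1 / 2\<^sup>2 * (norm v)\<^sup>2 \<le> (norm (J *v v))\<^sup>2" "(norm (J *v v))\<^sup>2 \<le> 2\<^sup>2 * (norm v)\<^sup>2" for v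
    using power_mono[OF N(1), of v 2] power_mono[OF N(2), of v 2]
    by (simp_all add: power_divide power_mult_distrib)
  then show "loewner_le (mat (1 / 2\<^sup>2)) (transpose J ** J)" "loewner_le (transpose J ** J) (mat (2\<^sup>2))"
    by (rule loewner_gramI)+
qed

lemma shift_regular:
  assumes "2 < \<alpha>"
    and "1 + 2 * CARD('d) * bump_bound (Suc (holder_order \<alpha>)) ^ CARD('d) * (A * m powr (\<alpha> - 1)) \<le> H"
  shows "\<phi> \<theta> \<in> regular_holder_class 2 \<alpha> unit_cube H"
  using shift_holder_class[OF m A assms(1) refl assms(2)] shift_loewner
  by (simp add: regular_holder_class_def)

lemma shift_nth: "i \<noteq> e \<Longrightarrow> \<phi> \<theta> x $ i = x $ i"
  by (simp add: shift_def axis_def)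

lemma field_eq_0_on_grid:
  assumes "m * x $ e = real j"
  shows "field m \<theta> c x = 0"
proof (rule field_not_in_cell)
  fix k assume "k \<in> \<theta>"
  show "x \<notin> cell m k"
  proof
    assume "x \<in> cell m k"
    then have "0 < m * x $ e - k e" "m * x $ e - k e < 1" by (auto simp: cell_def)
    with assms have "real (k e) < real j" "real j < real (k e + 1)" by auto
    then show False unfolding of_nat_less_iff by simp
  qed
qed

lemma shift_on_grid: "m * x $ e = real j \<Longrightarrow> \<phi> \<theta> x = x"
  by (simp add: shift_def field_eq_0_on_grid)

lemma shift_insert_coord_has_derivative:
  "((\<lambda>t. \<phi> \<theta> (insert_coord e y t) $ e) has_real_derivative slope \<theta> (insert_coord e y t)) (at t)"
proof -
  have "((\<lambda>h. field m \<theta> (\<lambda>_. 0) (insert_coord e y t + h *\<^sub>R axis e 1)) has_real_derivative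
     m * field m \<theta> ((\<lambda>_. 0)(e := Suc 0)) (insert_coord e y t)) (at 0)"
    by (rule field_partial)
  then have "((\<lambda>h. field m \<theta> (\<lambda>_. 0) (insert_coord e y (h + t))) has_real_derivative
     m * field m \<theta> ((\<lambda>_. 0)(e := Suc 0)) (insert_coord e y t)) (at 0)"
    by (simp add: insert_coord_add[symmetric] add.commute)
  then have "((\<lambda>t. field m \<theta> (\<lambda>_. 0) (insert_coord e y t)) has_real_derivative
     m * field m \<theta> ((\<lambda>_. 0)(e := Suc 0)) (insert_coord e y t)) (at t)"
    using DERIV_shift[of "\<lambda>t. field m \<theta> (\<lambda>_. 0) (insert_coord e y t)" _ 0 t] by simp
  then have "((\<lambda>t. t + A / m * field m \<theta> (\<lambda>_. 0) (insert_coord e y t)) has_real_derivative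
     1 + A / m * (m * field m \<theta> ((\<lambda>_. 0)(e := Suc 0)) (insert_coord e y t))) (at t)"
    by (intro DERIV_add DERIV_ident DERIV_cmult)
  then show ?thesis
    using m by (simp add: shift_def slope_def axis_def)
qed

lemma shift_strict_mono:
  assumes "\<And>i. i \<noteq> e \<Longrightarrow> x $ i = y $ i" "x $ e < y $ e"
  shows "\<phi> \<theta> x $ e < \<phi> \<theta> y $ e"
proof -
  have x: "x = insert_coord e y (x $ e)"
    using assms(1) by (simp add: vec_eq_iff insert_coord_nth)
  have "\<phi> \<theta> (insert_coord e y (x $ e)) $ e < \<phi> \<theta> (insert_coord e y (y $ e)) $ e"
  proof (rule DERIV_pos_imp_increasing[OF assms(2)])
    show "\<exists>D. ((\<lambda>t. \<phi> \<theta> (insert_coord e y t) $ e) has_real_derivative D) (at t) \<and> 0 < D" for t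
      using shift_insert_coord_has_derivative[of \<theta> y t] slope_bounds(1)[of \<theta> "insert_coord e y t"]
      by (intro exI[of _ "slope \<theta> (insert_coord e y t)"]) auto
  qed
  with x show ?thesis by (simp add: insert_coord_id)
qed

text \<open>The map fixes every point of a grid hyperplane orthogonal to \<open>e\<close> and is
  strictly increasing on lines parallel to \<open>e\<close>, so no point can cross such a
  hyperplane. Invariance of cells and of the cube follows.\<close>

lemma shift_less_grid_iff:
  shows "m * \<phi> \<theta> x $ e < real j \<longleftrightarrow> m * x $ e < real j"
    and "real j < m * \<phi> \<theta> x $ e \<longleftrightarrow> real j < m * x $ e"
proof -
  define y where "y = insert_coord e x (j / m)"
  have y: "m * y $ e = real j" "\<And>i. i \<noteq> e \<Longrightarrow> x $ i = y $ i"
    using m by (auto simp: y_def insert_coord_nth)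
  have yy: "\<phi> \<theta> y = y" by (rule shift_on_grid[OF y(1)])
  have *: "x $ e < y $ e \<Longrightarrow> \<phi> \<theta> x $ e < y $ e" "y $ e < x $ e \<Longrightarrow> y $ e < \<phi> \<theta> x $ e"
    using shift_strict_mono[of x y \<theta>] shift_strict_mono[of y x \<theta>] y(2) yy by auto
  have **: "\<phi> \<theta> x $ e = y $ e" if "x $ e = y $ e"
    using shift_on_grid[of x j \<theta>] that y(1) by simp
  have conv: "(m * t < real j) = (t < y $ e)" "(real j < m * t) = (y $ e < t)" for t :: real
    using m by (auto simp flip: y(1))
  have "(\<phi> \<theta> x $ e < y $ e) = (x $ e < y $ e)" "(y $ e < \<phi> \<theta> x $ e) = (y $ e < x $ e)"
    subgoal using * ** by (cases "x $ e" "y $ e" rule: linorder_cases) auto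
    subgoal using * ** by (cases "x $ e" "y $ e" rule: linorder_cases) auto
    done
  then show "m * \<phi> \<theta> x $ e < real j \<longleftrightarrow> m * x $ e < real j"
    "real j < m * \<phi> \<theta> x $ e \<longleftrightarrow> real j < m * x $ e"
    by (simp_all only: conv)
qed

lemma shift_in_cell_iff: "\<phi> \<theta> x \<in> cell m k \<longleftrightarrow> x \<in> cell m k"
proof -
  have "(0 < m * \<phi> \<theta> x $ i - k i \<and> m * \<phi> \<theta> x $ i - k i < 1) \<longleftrightarrow>
      (0 < m * x $ i - k i \<and> m * x $ i - k i < 1)" for i
    using shift_less_grid_iff(2)[of "k e" \<theta> x] shift_less_grid_iff(1)[of \<theta> x "Suc (k e)"]
    by (cases "i = e") (auto simp: shift_nth algebra_simps)
  then show ?thesis by (simp add: cell_def)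
qed

lemma shift_in_cube_iff: "\<phi> \<theta> x \<in> unit_cube \<longleftrightarrow> x \<in> unit_cube"
proof -
  \<comment> \<open>The two faces orthogonal to \<open>e\<close> are the grid hyperplanes with
    \<open>j = 0\<close> and \<open>j = m\<close>.\<close>
  have "(0 \<le> \<phi> \<theta> x $ i \<and> \<phi> \<theta> x $ i \<le> 1) \<longleftrightarrow> (0 \<le> x $ i \<and> x $ i \<le> 1)" for i
    using shift_less_grid_iff(1)[of \<theta> x 0] shift_less_grid_iff(2)[of m \<theta> x] m
    by (cases "i = e") (auto simp: shift_nth mult_less_0_iff not_less[symmetric])
  then show ?thesis by (simp add: cube_nth)
qed

lemma shift_inj: "inj (\<phi> \<theta>)"
proof (rule injI)
  fix x y assume eq: "\<phi> \<theta> x = \<phi> \<theta> y"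
  have ne: "x $ i = y $ i" if "i \<noteq> e" for i
    using shift_nth[OF that, of \<theta> x] shift_nth[OF that, of \<theta> y] eq by simp
  have "\<not> x $ e < y $ e" "\<not> y $ e < x $ e"
    using shift_strict_mono[of x y \<theta>] shift_strict_mono[of y x \<theta>] eq ne by auto
  then have "x $ i = y $ i" for i
    using ne[of i] by (cases "i = e") auto
  then show "x = y" by (simp add: vec_eq_iff)
qed

lemma shift_insert_coord: "insert_coord e y (\<phi> \<theta> (insert_coord e y t) $ e) = \<phi> \<theta> (insert_coord e y t)"
  by (simp add: vec_eq_iff insert_coord_nth shift_nth)

lemma shift_insert_ends:
  "\<phi> \<theta> (insert_coord e y 0) $ e = 0" "\<phi> \<theta> (insert_coord e y 1) $ e = 1"
  by (simp_all add: shift_on_grid[of _ 0] shift_on_grid[of _ m])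

text \<open>Surjectivity is the intermediate value theorem on each line parallel to
  \<open>e\<close>, whose end points in the cube are fixed.\<close>

lemma shift_bij: "bij_betw (\<phi> \<theta>) unit_cube unit_cube"
proof -
  have "x \<in> \<phi> \<theta> ` unit_cube" if x: "x \<in> unit_cube" for x
  proof -
    have "continuous_on {0..1} (\<lambda>t. \<phi> \<theta> (insert_coord e x t) $ e)"
      by (rule DERIV_continuous_on, rule has_field_derivative_at_within,
          rule shift_insert_coord_has_derivative)
    then have "\<exists>t. 0 \<le> t \<and> t \<le> 1 \<and> \<phi> \<theta> (insert_coord e x t) $ e = x $ e"
      by (rule IVT'[rotated 3]) (use x in \<open>simp_all add: shift_insert_ends cube_nth\<close>)
    then obtain t where "\<phi> \<theta> (insert_coord e x t) $ e = x $ e" by blast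
    then have "\<phi> \<theta> (insert_coord e x t) = x"
      using shift_insert_coord[of x \<theta> t] by (simp add: insert_coord_id)
    moreover from this have "insert_coord e x t \<in> unit_cube"
      using x shift_in_cube_iff[of \<theta> "insert_coord e x t"] by simp
    ultimately show ?thesis by (metis image_eqI)
  qed
  then show ?thesis
    using inj_on_subset[OF shift_inj subset_UNIV] by (auto simp: bij_betw_def shift_in_cube_iff)
qed

lemma inv_shift [simp]: "x \<in> unit_cube \<Longrightarrow> inv_into unit_cube (\<phi> \<theta>) (\<phi> \<theta> x) = x"
  by (rule inv_into_f_f[OF inj_on_subset[OF shift_inj subset_UNIV]])

lemma shift_inv:
  assumes "x \<in> unit_cube"
  shows "inv_into unit_cube (\<phi> \<theta>) x \<in> unit_cube" "\<phi> \<theta> (inv_into unit_cube (\<phi> \<theta>) x) = x"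
  using assms bij_betw_imp_surj_on[OF shift_bij[of \<theta>]]
    inv_into_into[of x "\<phi> \<theta>" unit_cube] f_inv_into_f[of x "\<phi> \<theta>" unit_cube] by simp_all

lemma dens_shift: "x \<in> unit_cube \<Longrightarrow> dens \<theta> (\<phi> \<theta> x) = 1 / slope \<theta> x"
  by (simp add: dens_def)

lemma dens_bounds: "2 / 3 \<le> dens \<theta> x" "dens \<theta> x \<le> 2"
proof -
  have "1 / 2 \<le> slope \<theta> (inv_into unit_cube (\<phi> \<theta>) x)" "slope \<theta> (inv_into unit_cube (\<phi> \<theta>) x) \<le> 3 / 2"
    by (rule slope_bounds)+
  then show "2 / 3 \<le> dens \<theta> x" "dens \<theta> x \<le> 2"
    by (auto simp: dens_def field_simps)
qed

lemma dens_eq_inverse_det: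
  assumes "x \<in> unit_cube"
  shows "dens \<theta> x = inverse \<bar>det (jacobian (\<phi> \<theta>) (at (inv_into unit_cube (\<phi> \<theta>) x) within unit_cube))\<bar>"
  using slope_bounds(1)[of \<theta> "inv_into unit_cube (\<phi> \<theta>) x"]
  by (simp add: det_jacobian_shift shift_inv[OF assms] dens_def inverse_eq_divide)

text \<open>If the fields agree at the preimage of \<open>x\<close> under one map, the other map
  sends that same point to \<open>x\<close>, and with the same slope. Agreement is assumed for all
  \<open>c\<close> because both the displacement and its derivative are needed.\<close>

lemma dens_cong:
  assumes x: "x \<in> unit_cube"
    and eq: "\<And>c. field m \<theta> c (inv_into unit_cube (\<phi> \<theta>) x) = field m \<theta>' c (inv_into unit_cube (\<phi> \<theta>) x)"
  shows "dens \<theta> x = dens \<theta>' x"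
proof -
  define y where "y = inv_into unit_cube (\<phi> \<theta>) x"
  have y: "y \<in> unit_cube" "\<phi> \<theta> y = x" using shift_inv[OF x] by (auto simp: y_def)
  have "\<phi> \<theta>' y = x" using eq y(2) by (simp add: shift_def flip: y_def)
  then have "dens \<theta>' x = 1 / slope \<theta>' y" using dens_shift[OF y(1), of \<theta>'] by simp
  moreover have "dens \<theta> x = 1 / slope \<theta> y" by (simp add: dens_def y_def)
  moreover have "slope \<theta> y = slope \<theta>' y" using eq by (simp add: slope_def y_def)
  ultimately show ?thesis by simp
qed

lemma inv_shift_in_cell_iff:
  "x \<in> unit_cube \<Longrightarrow> inv_into unit_cube (\<phi> \<theta>) x \<in> cell m k \<longleftrightarrow> x \<in> cell m k"
  using shift_in_cell_iff[of \<theta> "inv_into unit_cube (\<phi> \<theta>) x" k] shift_inv by simp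

lemma dens_in_cell:
  assumes "x \<in> unit_cube" "x \<in> cell m k" "finite \<theta>" "finite \<theta>'" "k \<in> \<theta> \<longleftrightarrow> k \<in> \<theta>'"
  shows "dens \<theta> x = dens \<theta>' x"
  using assms inv_shift_in_cell_iff[OF assms(1), of \<theta> k]
  by (intro dens_cong) (auto simp: field_in_cell)

lemma dens_insert:
  assumes "x \<in> unit_cube" "x \<notin> cell m k" "finite \<theta>"
  shows "dens (insert k \<theta>) x = dens \<theta> x"
proof (rule dens_cong[OF assms(1), symmetric])
  show "field m \<theta> c (inv_into unit_cube (\<phi> \<theta>) x)
     = field m (insert k \<theta>) c (inv_into unit_cube (\<phi> \<theta>) x)" for c
    using assms inv_shift_in_cell_iff[OF assms(1), of \<theta> k]
    by (cases "k \<in> \<theta>") (auto simp: field_def insert_absorb tile_eq_0)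
qed

lemma dens_empty: "x \<in> unit_cube \<Longrightarrow> dens {} x = 1"
  by (simp add: dens_def slope_def field_def)

end

section \<open>Change of variables\<close>

lemma prod_Basis_cart: "(\<Prod>b\<in>(Basis :: (real^'d::finite) set). x \<bullet> b) = (\<Prod>i\<in>UNIV. x $ i)"
proof -
  have B: "(Basis :: (real^'d) set) = range (\<lambda>i. axis i 1)"
    by (auto simp: Basis_vec_def)
  have "inj (\<lambda>i::'d. axis i (1::real))"
    by (auto simp: inj_on_def axis_eq_axis)
  then show ?thesis
    by (simp add: B prod.reindex inner_axis)
qed

lemma emeasure_box_cart:
  fixes l u :: "real^'d::finite"
  assumes "\<And>i. l $ i \<le> u $ i"
  shows "emeasure lborel (box l u) = ennreal (\<Prod>i\<in>UNIV. u $ i - l $ i)"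
proof -
  have "l \<bullet> b \<le> u \<bullet> b" if "b \<in> Basis" for b
    using that assms by (auto simp: Basis_vec_def inner_axis)
  then show ?thesis
    using prod_Basis_cart[of "u - l"] by simp
qed

lemma insert_coord_continuous: "continuous_on UNIV (\<lambda>p. insert_coord e (fst p) (snd p))"
  by (auto simp: insert_coord_def intro!: continuous_intros)

lemma insert_coord_measurable [measurable]:
  "(\<lambda>p. insert_coord e (fst p) (snd p)) \<in> borel_measurable (borel \<Otimes>\<^sub>M borel)"
  unfolding borel_prod by (rule borel_measurable_continuous_onI[OF insert_coord_continuous])

lemma vec_nth_measurable: "(\<lambda>y :: real^'d::finite. y $ e) \<in> borel_measurable borel"
  by (intro borel_measurable_continuous_onI continuous_intros)

text \<open>
  Resampling one coordinate: the change-of-variables theorems of the library need a well-ordered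
  index type, so the substitution along \<open>e\<close> is done by Fubini and the one-dimensional rule.
\<close>

lemma lborel_insert_coord:
  fixes e :: "'d::finite"
  shows "lborel = distr (density lborel (\<lambda>y. indicator {0<..<1} (y $ e)) \<Otimes>\<^sub>M lborel) borel
     (\<lambda>p. insert_coord e (fst p) (snd p))"
proof (rule lborel_eqI)
  \<comment> \<open>Coordinate \<open>e\<close> of \<open>y\<close> is a dummy, confined to an
    interval of length one and later overwritten by \<open>t\<close>. Thus \<open>?P\<close> acts as
    Lebesgue measure in the remaining coordinates while staying on the same space.\<close>
  let ?P = "density lborel (\<lambda>y::real^'d. indicator {0<..<1} (y $ e) :: ennreal)"
  have ind: "(\<lambda>y::real^'d. indicator {0<..<1} (y $ e) :: ennreal) \<in> borel_measurable borel"
    by (rule measurable_compose[OF vec_nth_measurable]) simp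
  fix l u :: "real^'d" assume lu: "\<And>b. b \<in> Basis \<Longrightarrow> l \<bullet> b \<le> u \<bullet> b"
  have le: "l $ i \<le> u $ i" for i
    using lu[of "axis i 1"] by (auto simp: Basis_vec_def inner_axis)
  define S where "S = {y::real^'d. \<forall>i. i \<noteq> e \<longrightarrow> l $ i < y $ i \<and> y $ i < u $ i}"
  have "S = (\<Inter>i\<in>UNIV - {e}. {y. l $ i < y $ i \<and> y $ i < u $ i})"
    by (auto simp: S_def)
  then have "open S"
    by (auto intro!: open_INT open_Collect_conj open_Collect_less continuous_intros)
  then have S: "S \<in> sets borel" by simp
  have "emeasure ?P S = (\<integral>\<^sup>+y. indicator {0<..<1} (y $ e) * indicator S y \<partial>lborel)"
    using S ind by (subst emeasure_density) auto
  also have "\<dots> = (\<integral>\<^sup>+y. indicator (box (insert_coord e l 0) (insert_coord e u 1)) y \<partial>lborel)"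
    by (intro nn_integral_cong)
       (auto simp: S_def mem_box_cart insert_coord_nth indicator_def split: if_splits)
  also have "\<dots> = ennreal (\<Prod>i\<in>UNIV. insert_coord e u 1 $ i - insert_coord e l 0 $ i)"
    using le by (simp add: emeasure_box_cart insert_coord_nth)
  also have "(\<Prod>i\<in>UNIV. insert_coord e u 1 $ i - insert_coord e l 0 $ i) = (\<Prod>i\<in>UNIV - {e}. u $ i - l $ i)"
    by (subst prod.remove[of _ e]) (auto simp: insert_coord_nth intro!: prod.cong)
  finally have PS: "emeasure ?P S = ennreal (\<Prod>i\<in>UNIV - {e}. u $ i - l $ i)" .
  have vim: "(\<lambda>p. insert_coord e (fst p) (snd p)) -` box l u \<inter> space (?P \<Otimes>\<^sub>M lborel)
      = S \<times> {l $ e<..<u $ e}"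
    by (auto simp: S_def space_pair_measure mem_box_cart insert_coord_nth split: if_splits)
  have meas: "(\<lambda>p. insert_coord e (fst p) (snd p)) \<in> measurable (?P \<Otimes>\<^sub>M lborel) borel"
    using insert_coord_measurable[of e] by (simp cong: measurable_cong_sets sets_pair_measure_cong)
  have "emeasure (distr (?P \<Otimes>\<^sub>M lborel) borel (\<lambda>p. insert_coord e (fst p) (snd p))) (box l u)
      = emeasure ?P S * emeasure lborel {l $ e<..<u $ e}"
    using meas S by (subst emeasure_distr) (auto simp: vim intro!: lborel.emeasure_pair_measure_Times)
  also have "\<dots> = ennreal ((u $ e - l $ e) * (\<Prod>i\<in>UNIV - {e}. u $ i - l $ i))"
    using le by (simp add: PS ennreal_mult' prod_nonneg mult.commute)
  also have "\<dots> = ennreal (\<Prod>i\<in>UNIV. u $ i - l $ i)"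
    by (subst (2) prod.remove[of _ e]) auto
  finally show "emeasure (distr (?P \<Otimes>\<^sub>M lborel) borel (\<lambda>p. insert_coord e (fst p) (snd p))) (box l u)
      = ennreal (\<Prod>b\<in>Basis. (u - l) \<bullet> b)"
    by (simp add: prod_Basis_cart)
qed simp

lemma nn_integral_insert_coord:
  fixes G :: "real^'d::finite \<Rightarrow> ennreal"
  assumes G [measurable]: "G \<in> borel_measurable borel"
  shows "(\<integral>\<^sup>+x. G x \<partial>lborel)
    = (\<integral>\<^sup>+y. indicator {0<..<1} (y $ e) * (\<integral>\<^sup>+t. G (insert_coord e y t) \<partial>lborel) \<partial>lborel)"
proof -
  let ?P = "density lborel (\<lambda>y::real^'d. indicator {0<..<1} (y $ e) :: ennreal)"
  have ind [measurable]: "(\<lambda>y::real^'d. indicator {0<..<1} (y $ e) :: ennreal) \<in> borel_measurable borel"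
    by (rule measurable_compose[OF vec_nth_measurable]) simp
  have sets: "sets (?P \<Otimes>\<^sub>M lborel) = sets (borel \<Otimes>\<^sub>M (borel :: real measure))"
    by (simp cong: sets_pair_measure_cong)
  have meas: "(\<lambda>p. insert_coord e (fst p) (snd p)) \<in> measurable (?P \<Otimes>\<^sub>M lborel) borel"
    using insert_coord_measurable[of e] by (simp cong: measurable_cong_sets sets_pair_measure_cong)
  have GM: "(\<lambda>p. G (insert_coord e (fst p) (snd p))) \<in> borel_measurable (?P \<Otimes>\<^sub>M lborel)"
    using measurable_compose[OF meas G] .
  have GM': "(\<lambda>p. G (insert_coord e (fst p) (snd p))) \<in> borel_measurable (lborel \<Otimes>\<^sub>M lborel)"
    using measurable_compose[OF insert_coord_measurable G]
    by (simp cong: measurable_cong_sets sets_pair_measure_cong)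
  have "(\<integral>\<^sup>+x. G x \<partial>lborel) =
      (\<integral>\<^sup>+x. G x \<partial>distr (?P \<Otimes>\<^sub>M lborel) borel (\<lambda>p. insert_coord e (fst p) (snd p)))"
    by (rule arg_cong[where f="\<lambda>M. integral\<^sup>N M G"], rule lborel_insert_coord)
  also have "\<dots> = (\<integral>\<^sup>+p. G (insert_coord e (fst p) (snd p)) \<partial>(?P \<Otimes>\<^sub>M lborel))"
    by (rule nn_integral_distr[OF meas]) simp
  also have "\<dots> = (\<integral>\<^sup>+y. \<integral>\<^sup>+t. G (insert_coord e y t) \<partial>lborel \<partial>?P)"
    using lborel.nn_integral_fst[OF GM] by simp
  also have "\<dots> = (\<integral>\<^sup>+y. indicator {0<..<1} (y $ e) * (\<integral>\<^sup>+t. G (insert_coord e y t) \<partial>lborel) \<partial>lborel)"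
    using lborel.borel_measurable_nn_integral_fst[OF GM'] by (intro nn_integral_density) (auto simp: ind)
  finally show ?thesis .
qed

lemma set_nn_integral_cube_insert_coord:
  fixes F :: "real^'d::finite \<Rightarrow> ennreal"
  assumes F [measurable]: "F \<in> borel_measurable borel"
  shows "(\<integral>\<^sup>+x\<in>unit_cube. F x \<partial>lborel) = (\<integral>\<^sup>+y. indicator {0<..<1} (y $ e) *
     ((if \<forall>i. i \<noteq> e \<longrightarrow> 0 \<le> y $ i \<and> y $ i \<le> 1 then 1 else 0) *
       (\<integral>\<^sup>+t. F (insert_coord e y t) * indicator {0..1} t \<partial>lborel)) \<partial>lborel)"
proof -
  have ind: "indicator unit_cube (insert_coord e y t)
      = (if \<forall>i. i \<noteq> e \<longrightarrow> 0 \<le> y $ i \<and> y $ i \<le> 1 then 1 else 0) * (indicator {0..1} t :: ennreal)" for y t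
    by (auto simp: indicator_def cube_nth insert_coord_nth)
  have meas: "(\<lambda>t. F (insert_coord e y t) * indicator {0..1} t) \<in> borel_measurable lborel" for y
  proof -
    have "continuous_on UNIV (insert_coord e y)"
      unfolding insert_coord_def by (intro continuous_intros)
    from measurable_compose[OF borel_measurable_continuous_onI[OF this] F] show ?thesis
      by simp
  qed
  have "(\<integral>\<^sup>+t. F (insert_coord e y t) * indicator unit_cube (insert_coord e y t) \<partial>lborel) =
      (if \<forall>i. i \<noteq> e \<longrightarrow> 0 \<le> y $ i \<and> y $ i \<le> 1 then 1 else 0) *
       (\<integral>\<^sup>+t. F (insert_coord e y t) * indicator {0..1} t \<partial>lborel)" for y
    by (simp only: ind flip: nn_integral_cmult[OF meas]) (simp add: mult_ac)
  then show ?thesis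
    by (subst nn_integral_insert_coord[where e=e]) simp_all
qed

context shift_map
begin

lemma shift_measurable [measurable]: "\<phi> \<theta> \<in> borel_measurable borel"
  by (intro borel_measurable_continuous_onI has_derivative_continuous_on)
     (rule shift_has_derivative)

lemma slope_continuous: "continuous_on S (slope \<theta>)"
  unfolding slope_def[abs_def] by (intro continuous_intros field_continuous)

lemma slope_measurable [measurable]: "slope \<theta> \<in> borel_measurable borel"
  by (intro borel_measurable_continuous_onI slope_continuous)

text \<open>On each line parallel to \<open>e\<close> this is substitution by an increasing map of
  \<open>{0..1}\<close> onto itself with derivative \<open>slope\<close>; the other coordinates are
  untouched.\<close>

lemma nn_integral_shift:
  fixes F :: "real^'d \<Rightarrow> ennreal"
  assumes F [measurable]: "F \<in> borel_measurable borel"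
  shows "(\<integral>\<^sup>+x\<in>unit_cube. F x \<partial>lborel) = (\<integral>\<^sup>+x\<in>unit_cube. F (\<phi> \<theta> x) * ennreal (slope \<theta> x) \<partial>lborel)"
proof -
  have "(\<integral>\<^sup>+t. F (insert_coord e y t) * indicator {0..1} t \<partial>lborel)
      = (\<integral>\<^sup>+t. F (\<phi> \<theta> (insert_coord e y t)) * ennreal (slope \<theta> (insert_coord e y t)) * indicator {0..1} t \<partial>lborel)" for y
  proof -
    have cont: "continuous_on S (insert_coord e y)" for S
      unfolding insert_coord_def by (intro continuous_intros)
    have meas: "(\<lambda>t. F (insert_coord e y t)) \<in> borel_measurable borel"
      using measurable_compose[OF borel_measurable_continuous_onI[OF cont] F] .
    have sc: "continuous_on {0..1} (\<lambda>t. slope \<theta> (insert_coord e y t))"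
      by (rule continuous_on_compose2[OF slope_continuous cont]) auto
    have "(\<integral>\<^sup>+t. F (insert_coord e y t) * indicator {\<phi> \<theta> (insert_coord e y 0) $ e..\<phi> \<theta> (insert_coord e y 1) $ e} t \<partial>lborel)
      = (\<integral>\<^sup>+t. F (insert_coord e y (\<phi> \<theta> (insert_coord e y t) $ e)) * ennreal (slope \<theta> (insert_coord e y t)) * indicator {0..1} t \<partial>lborel)"
      by (rule nn_integral_substitution_aux[OF meas _ shift_insert_coord_has_derivative sc])
         (use slope_bounds(1) in \<open>auto intro: order_trans[of _ "1/2"]\<close>)
    then show ?thesis by (simp add: shift_insert_ends shift_insert_coord)
  qed
  then show ?thesis
    by (subst (1 2) set_nn_integral_cube_insert_coord[where e=e]) simp_all
qed

lemma dens_continuous: "continuous_on unit_cube (dens \<theta>)"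
proof -
  have "continuous_on (\<phi> \<theta> ` unit_cube) (inv_into unit_cube (\<phi> \<theta>))"
    by (rule continuous_on_inv) (auto intro: has_derivative_continuous_on shift_has_derivative)
  then have "continuous_on unit_cube (inv_into unit_cube (\<phi> \<theta>))"
    using bij_betw_imp_surj_on[OF shift_bij] by simp
  from continuous_on_compose2[OF slope_continuous this subset_UNIV]
  have "continuous_on unit_cube (\<lambda>x. slope \<theta> (inv_into unit_cube (\<phi> \<theta>) x))" .
  then show ?thesis
    unfolding dens_def[abs_def]
  proof (intro continuous_on_divide continuous_on_const ballI)
    show "slope \<theta> (inv_into unit_cube (\<phi> \<theta>) x) \<noteq> 0" for x
      using slope_bounds(1)[of \<theta> "inv_into unit_cube (\<phi> \<theta>) x"] by linarith
  qed
qed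

lemma dens_measurable [measurable]: "dens \<theta> \<in> borel_measurable cube_measure"
proof -
  have "dens \<theta> \<in> borel_measurable (restrict_space borel unit_cube)"
    by (rule borel_measurable_continuous_on_restrict[OF dens_continuous])
  then show ?thesis
    by (simp cong: measurable_cong_sets sets_restrict_space_cong)
qed

text \<open>Pulls an integral of the density back to one of the explicit \<open>slope\<close>. The
  invariant set \<open>S\<close> is the whole space when the total mass is computed and a single
  cell when the gap is.\<close>

lemma nn_integral_dens:
  fixes h :: "real \<Rightarrow> ennreal"
  assumes h [measurable]: "h \<in> borel_measurable borel"
    and S [measurable]: "S \<in> sets borel" "\<And>x. \<phi> \<theta> x \<in> S \<longleftrightarrow> x \<in> S"
  shows "(\<integral>\<^sup>+x\<in>S. h (dens \<theta> x) \<partial>cube_measure)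
    = (\<integral>\<^sup>+x\<in>S. h (1 / slope \<theta> x) * ennreal (slope \<theta> x) \<partial>cube_measure)"
proof -
  \<comment> \<open>The density is extended by zero off the cube, because the change of variables
    asks for a Borel function on the whole space.\<close>
  define F where "F x = h (indicator unit_cube x *\<^sub>R dens \<theta> x) * indicator S x" for x
  have "(\<lambda>x. indicator unit_cube x *\<^sub>R dens \<theta> x) \<in> borel_measurable borel"
    by (rule borel_measurable_continuous_on_indicator[OF _ dens_continuous]) simp
  then have F: "F \<in> borel_measurable borel"
    unfolding F_def by measurable
  have "(\<integral>\<^sup>+x\<in>S. h (dens \<theta> x) \<partial>cube_measure) = (\<integral>\<^sup>+x\<in>unit_cube. F x \<partial>lborel)"
    by (subst nn_integral_restrict_space) (auto simp: F_def indicator_def intro!: nn_integral_cong)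
  also have "\<dots> = (\<integral>\<^sup>+x\<in>unit_cube. F (\<phi> \<theta> x) * ennreal (slope \<theta> x) \<partial>lborel)"
    by (rule nn_integral_shift[OF F])
  also have "\<dots> = (\<integral>\<^sup>+x\<in>S. h (1 / slope \<theta> x) * ennreal (slope \<theta> x) \<partial>cube_measure)"
    by (subst nn_integral_restrict_space)
       (auto simp: F_def indicator_def S(2) shift_in_cube_iff dens_shift intro!: nn_integral_cong)
  finally show ?thesis .
qed

end

section \<open>Total mass of the perturbed densities and membership in the class\<close>

lemma emeasure_cube: "emeasure lborel (unit_cube :: (real^'d::finite) set) = 1"
proof -
  have "(0::real^'d) \<bullet> b \<le> 1 \<bullet> b" if "b \<in> Basis" for b
    using that by (auto simp: Basis_vec_def inner_axis)
  then show ?thesis using prod_Basis_cart[of "1 - 0 :: real^'d"] by simp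
qed

lemma prob_space_cube: "prob_space cube_measure"
  by (rule prob_spaceI) (simp add: emeasure_restrict_space emeasure_cube)

lemma (in shift_map) prob_density_dens: "prob_density (dens \<theta>)"
proof -
  have "(\<integral>\<^sup>+x. ennreal (dens \<theta> x) \<partial>cube_measure) = (\<integral>\<^sup>+x\<in>UNIV. ennreal (1 / slope \<theta> x) * ennreal (slope \<theta> x) \<partial>cube_measure)"
    using nn_integral_dens[of ennreal UNIV \<theta>] by simp
  also have "\<dots> = (\<integral>\<^sup>+x. 1 \<partial>(cube_measure :: (real^'d) measure))"
  proof (intro nn_integral_cong)
    fix x
    have "0 < slope \<theta> x" using slope_bounds(1)[of \<theta> x] by linarith
    then show "ennreal (1 / slope \<theta> x) * ennreal (slope \<theta> x) * indicator UNIV x = 1"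
      by (simp flip: ennreal_mult')
  qed
  also have "\<dots> = 1" using prob_space.emeasure_space_1[OF prob_space_cube] by simp
  finally show ?thesis
    using dens_bounds(1)[of \<theta>] by (auto simp: prob_density_def intro: order_trans[of _ "2/3"])
qed

lemma (in shift_map) dens_in_class:
  assumes "2 < \<beta>"
    and "1 + 2 * CARD('d) * bump_bound (Suc (holder_order (1 + \<beta>))) ^ CARD('d) * (A * m powr \<beta>) \<le> H"
  shows "dens \<theta> \<in> density_class \<beta> H 2"
  unfolding density_class_def
  using prob_density_dens shift_bij[of \<theta>] shift_regular[of "1 + \<beta>" H \<theta>] assms dens_eq_inverse_det[of _ \<theta>]
  by (intro CollectI conjI exI[of _ "\<phi> \<theta>"] ballI) auto

section \<open>The L2 energy of the differentiated bump\<close>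

definition energy_ennreal :: "'d::finite \<Rightarrow> ennreal" where
  "energy_ennreal e = (\<integral>\<^sup>+x. ennreal ((tile 1 ((\<lambda>_. 0)(e := 1)) (\<lambda>_. 0) x)\<^sup>2) \<partial>(lborel :: (real^'d) measure))"

definition energy :: "'d::finite \<Rightarrow> real" where
  "energy e = enn2real (energy_ennreal e)"

lemma tile_continuous: "continuous_on S (tile m c k)"
  by (rule has_derivative_continuous_on, rule has_derivative_at_withinI, rule tile_has_derivative)

lemma tile_measurable [measurable]: "tile m c k \<in> borel_measurable borel"
  by (intro borel_measurable_continuous_onI tile_continuous)

lemma energy_finite: "energy_ennreal (e :: 'd::finite) < \<infinity>"
proof -
  define B where "B = bump_bound 1 ^ CARD('d)"
  let ?c = "(\<lambda>_. 0)(e := 1) :: 'd \<Rightarrow> nat"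
  have "(tile 1 ?c (\<lambda>_. 0) x)\<^sup>2 \<le> B\<^sup>2" for x
  proof -
    have "\<bar>tile 1 ?c (\<lambda>_. 0) x\<bar> \<le> B" unfolding B_def by (rule tile_bound) simp
    then show ?thesis by (meson abs_ge_zero abs_le_square_iff order_trans abs_ge_self)
  qed
  moreover have "cell 1 (\<lambda>_. 0) \<subseteq> (unit_cube :: (real^'d) set)"
    by (rule cell_subset) (simp add: grid_def)
  then have "tile 1 ?c (\<lambda>_. 0) x = 0" if "x \<notin> unit_cube" for x
    using that tile_eq_0 by blast
  ultimately have "energy_ennreal e \<le> (\<integral>\<^sup>+x\<in>unit_cube. ennreal (B\<^sup>2) \<partial>(lborel :: (real^'d) measure))"
    unfolding energy_ennreal_def by (intro nn_integral_mono) (auto simp: indicator_def intro!: ennreal_leI)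
  also have "\<dots> = ennreal (B\<^sup>2)"
    by (simp add: nn_integral_cmult_indicator emeasure_cube)
  finally show ?thesis by (simp add: le_less_trans)
qed

lemma ennreal_energy: "ennreal (energy e) = energy_ennreal e"
  using energy_finite[of e] by (simp add: energy_def)

lemma energy_pos: "0 < energy (e :: 'd::finite)"
proof -
  let ?f = "tile 1 ((\<lambda>_. 0)(e := 1)) (\<lambda>_. 0) :: real^'d \<Rightarrow> real"
  obtain s where s: "bump (Suc 0) s \<noteq> 0" using bump_1_nonzero by blast
  \<comment> \<open>Coordinate \<open>e\<close> sits where the derivative of the bump is nonzero,
    the others where the bump is positive. By continuity the integrand is then nonzero on a box
    around \<open>z\<close>.\<close>
  define z :: "real^'d" where "z = (\<chi> i. if i = e then s else 1 / 2)"
  have "?f z \<noteq> 0"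
    using s bump_0_pos[of "1/2"] by (auto simp: tile_def z_def)
  moreover have "open {x. ?f x \<noteq> 0}"
    by (intro open_Collect_neq tile_continuous continuous_on_const)
  ultimately obtain l u where lu: "z \<in> box l u" "box l u \<subseteq> {x. ?f x \<noteq> 0}"
    using open_contains_box by (metis (mono_tags, lifting) mem_Collect_eq)
  have lt: "l $ i < u $ i" for i
  proof -
    have "l $ i < z $ i" "z $ i < u $ i" using lu(1) by (auto simp: mem_box_cart)
    then show ?thesis by simp
  qed
  have "energy_ennreal e \<noteq> 0"
  proof
    assume "energy_ennreal e = 0"
    then have "AE x in lborel. ?f x = 0"
      unfolding energy_ennreal_def by (subst (asm) nn_integral_0_iff_AE) (auto simp: ennreal_eq_0_iff)
    then have "AE x in lborel. x \<notin> box l u"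
      using lu(2) by (auto elim!: eventually_mono)
    then have "emeasure lborel (box l u) = 0"
      by (subst (asm) AE_iff_measurable[OF _ refl]) auto
    moreover have "0 < (\<Prod>i\<in>UNIV. u $ i - l $ i)" using lt by (intro prod_pos) simp
    moreover have "emeasure lborel (box l u) = ennreal (\<Prod>i\<in>UNIV. u $ i - l $ i)"
      using lt by (intro emeasure_box_cart less_imp_le)
    ultimately show False by (metis ennreal_eq_0_iff not_le)
  qed
  then show ?thesis
    using energy_finite[of e] by (simp add: energy_def enn2real_positive_iff zero_less_iff_neq_zero)
qed

text \<open>The affine substitution carrying the unit cell to cell \<open>k\<close> contributes only
  its volume \<open>1 / m ^ d\<close>, as \<open>tile\<close> carries no chain-rule factor.\<close>

lemma tile_energy:
  fixes e :: "'d::finite"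
  assumes "0 < m"
  shows "(\<integral>\<^sup>+x. ennreal ((tile m ((\<lambda>_. 0)(e := 1)) k x)\<^sup>2) \<partial>lborel) = ennreal (energy e / m ^ CARD('d))"
proof -
  let ?c = "(\<lambda>_. 0)(e := 1) :: 'd \<Rightarrow> nat"
  define t :: "real^'d" where "t = (\<chi> i. k i / m)"
  have t: "tile m ?c k (t + (1 / m) *\<^sub>R x) = tile 1 ?c (\<lambda>_. 0) x" for x
    using assms by (simp add: tile_def t_def distrib_left)
  have "(\<integral>\<^sup>+x. ennreal ((tile m ?c k x)\<^sup>2) \<partial>lborel)
     = (\<integral>\<^sup>+x. ennreal ((tile m ?c k x)\<^sup>2) \<partial>density (distr lborel borel (\<lambda>x. t + (1 / m) *\<^sub>R x)) (\<lambda>_. \<bar>1 / m\<bar>^DIM(real^'d)))"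
    using assms by (subst lborel_affine[of "1 / m" t]) auto
  also have "\<dots> = (\<integral>\<^sup>+x. ennreal ((1 / m) ^ CARD('d)) * ennreal ((tile 1 ?c (\<lambda>_. 0) x)\<^sup>2) \<partial>lborel)"
    by (subst nn_integral_density) (auto simp: nn_integral_distr t[simplified])
  also have "\<dots> = ennreal ((1 / m) ^ CARD('d)) * ennreal (energy e)"
    by (simp add: nn_integral_cmult energy_ennreal_def ennreal_energy)
  also have "\<dots> = ennreal (energy e / m ^ CARD('d))"
    using energy_pos[of e] by (simp add: power_one_over flip: ennreal_mult')
  finally show ?thesis .
qed

context shift_map
begin

text \<open>Off the perturbation the density is 1, so this is at once the chi-square cost of
  toggling cell \<open>k\<close> and the squared L2 distance between the two densities.\<close>

definition gap :: "('d \<Rightarrow> nat) \<Rightarrow> real" where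
  "gap k = (\<integral>x. indicator (cell m k) x * (dens {k} x - 1)\<^sup>2 \<partial>cube_measure)"

text \<open>After the change of variables the integrand is
  \<open>(1 / s - 1)^2 * s = (s - 1)^2 / s\<close> with \<open>s\<close> the slope, and
  \<open>s - 1\<close> is \<open>A\<close> times the tile. The constants 2/3 and 2 come from
  \<open>s\<close> lying between 1/2 and 3/2.\<close>

lemma gap_bounds:
  assumes k: "k \<in> grid m"
  shows "2 / 3 * (A\<^sup>2 * energy e / m ^ CARD('d)) \<le> gap k"
    and "gap k \<le> 2 * (A\<^sup>2 * energy e / m ^ CARD('d))"
proof -
  let ?c = "(\<lambda>_. 0)(e := 1) :: 'd \<Rightarrow> nat"
  let ?s = "slope {k}"
  have cell [measurable]: "cell m k \<in> sets borel" by (rule borel_open[OF open_cell])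
  define T where "T = (\<integral>\<^sup>+x\<in>cell m k. ennreal ((dens {k} x - 1)\<^sup>2) \<partial>cube_measure)"
  have "T = (\<integral>\<^sup>+x\<in>cell m k. ennreal ((1 / ?s x - 1)\<^sup>2) * ennreal (?s x) \<partial>cube_measure)"
    unfolding T_def
    by (rule nn_integral_dens[where h="\<lambda>r. ennreal ((r - 1)\<^sup>2)"]) (auto simp: shift_in_cell_iff)
  also have "\<dots> = (\<integral>\<^sup>+x. ennreal ((A * tile m ?c k x)\<^sup>2 / ?s x) \<partial>lborel)"
  proof -
    have "ennreal ((1 / ?s x - 1)\<^sup>2) * ennreal (?s x) * indicator (cell m k) x * indicator unit_cube x
        = ennreal ((A * tile m ?c k x)\<^sup>2 / ?s x)" for x
    proof (cases "x \<in> cell m k")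
      case True
      have s: "?s x = 1 + A * tile m ?c k x"
        using True by (simp add: slope_def field_in_cell)
      have pos: "0 < ?s x" using slope_bounds(1)[of "{k}" x] by linarith
      have "(1 / ?s x - 1)\<^sup>2 * ?s x = (?s x - 1)\<^sup>2 / ?s x"
        using pos by (simp add: field_simps power2_eq_square)
      then show ?thesis
        using True cell_subset[OF k] pos by (auto simp: s simp flip: ennreal_mult')
    next
      case False then show ?thesis by (simp add: tile_eq_0)
    qed
    then show ?thesis by (subst nn_integral_restrict_space) auto
  qed
  finally have T: "T = (\<integral>\<^sup>+x. ennreal ((A * tile m ?c k x)\<^sup>2 / ?s x) \<partial>lborel)" .
  have E: "(\<integral>\<^sup>+x. ennreal (r * (A * tile m ?c k x)\<^sup>2) \<partial>lborel) = ennreal (r * (A\<^sup>2 * energy e / m ^ CARD('d)))"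
    if "0 \<le> r" for r
  proof -
    have "(\<integral>\<^sup>+x. ennreal (r * (A * tile m ?c k x)\<^sup>2) \<partial>lborel)
        = (\<integral>\<^sup>+x. ennreal (r * A\<^sup>2) * ennreal ((tile m ?c k x)\<^sup>2) \<partial>lborel)"
      using that by (intro nn_integral_cong) (simp add: power_mult_distrib mult_ac flip: ennreal_mult')
    also have "\<dots> = ennreal (r * A\<^sup>2) * ennreal (energy e / m ^ CARD('d))"
      using m by (simp add: nn_integral_cmult tile_energy[simplified])
    also have "\<dots> = ennreal (r * (A\<^sup>2 * energy e / m ^ CARD('d)))"
      using that by (simp add: mult_ac flip: ennreal_mult')
    finally show ?thesis .
  qed
  have div: "2 / 3 * a \<le> a / ?s x \<and> a / ?s x \<le> 2 * a" if "0 \<le> a" for a x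
  proof -
    have s: "2 / 3 * ?s x \<le> 1" "1 \<le> 2 * ?s x"
      using slope_bounds[of "{k}" x] by auto
    note mult_left_mono[OF s(1) that] mult_left_mono[OF s(2) that]
    moreover have "0 < ?s x" using slope_bounds(1)[of "{k}" x] by linarith
    ultimately show ?thesis by (simp add: field_simps)
  qed
  have lo: "ennreal (2 / 3 * (A\<^sup>2 * energy e / m ^ CARD('d))) \<le> T"
  proof -
    have "(\<integral>\<^sup>+x. ennreal (2 / 3 * (A * tile m ?c k x)\<^sup>2) \<partial>lborel) \<le> T"
      unfolding T using div by (intro nn_integral_mono ennreal_leI) auto
    then show ?thesis by (subst (asm) E) auto
  qed
  have hi: "T \<le> ennreal (2 * (A\<^sup>2 * energy e / m ^ CARD('d)))"
  proof -
    have "T \<le> (\<integral>\<^sup>+x. ennreal (2 * (A * tile m ?c k x)\<^sup>2) \<partial>lborel)"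
      unfolding T using div by (intro nn_integral_mono ennreal_leI) auto
    then show ?thesis by (subst (asm) E) auto
  qed
  have cm: "indicator (cell m k) \<in> borel_measurable cube_measure"
    by (simp add: measurable_restrict_space1)
  have gm: "(\<lambda>x. indicator (cell m k) x * (dens {k} x - 1)\<^sup>2) \<in> borel_measurable cube_measure"
    using cm by (intro borel_measurable_times) simp_all
  have g: "gap k = enn2real T"
    unfolding gap_def T_def
    by (subst integral_eq_nn_integral[OF gm])
       (auto simp: indicator_def intro!: arg_cong[where f=enn2real] nn_integral_cong)
  have Tfin: "T < \<top>" using hi by (simp add: le_less_trans)
  have E0: "0 \<le> A\<^sup>2 * energy e / m ^ CARD('d)" using energy_pos[of e] by simp
  show "2 / 3 * (A\<^sup>2 * energy e / m ^ CARD('d)) \<le> gap k" "gap k \<le> 2 * (A\<^sup>2 * energy e / m ^ CARD('d))"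
    using enn2real_mono[OF lo Tfin] enn2real_mono[OF hi] E0 by (auto simp: g)
qed

end

section \<open>Jensen--Shannon divergence\<close>

text \<open>With \<open>x = s^2\<close> the inequality \<open>ln s \<ge> 1 - 1 / s\<close> gives
  \<open>x * ln x \<ge> x - 1 + (s - 1)^2\<close>, and
  \<open>(x - 1)^2 = (s - 1)^2 * (s + 1)^2\<close> where the last factor is at most 6 for
  \<open>x \<le> 2\<close>. That range suffices because a density is at most twice its average with
  another.\<close>

lemma ln_lower_quadratic:
  fixes x :: real
  assumes "0 < x" "x \<le> 2"
  shows "x - 1 + (x - 1)\<^sup>2 / 6 \<le> x * ln x"
proof -
  define s where "s = sqrt x"
  have s: "0 < s" "x = s\<^sup>2" using assms by (auto simp: s_def)
  have "s \<le> 3 / 2"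
    unfolding s_def using assms by (intro real_le_lsqrt) (auto simp: power2_eq_square)
  moreover have "(s + 1)\<^sup>2 = x + 2 * s + 1"
    by (simp add: s power2_eq_square algebra_simps)
  ultimately have "(s + 1)\<^sup>2 \<le> 6" using assms by linarith
  then have "(s - 1)\<^sup>2 * (s + 1)\<^sup>2 \<le> (s - 1)\<^sup>2 * 6"
    by (intro mult_left_mono) auto
  moreover have "(s - 1)\<^sup>2 * (s + 1)\<^sup>2 = (x - 1)\<^sup>2"
    by (simp add: s power2_eq_square algebra_simps)
  ultimately have 1: "(x - 1)\<^sup>2 / 6 \<le> (s - 1)\<^sup>2" by simp
  have "ln (1 / s) \<le> 1 / s - 1" using s by (intro ln_le_minus_one) simp
  then have "1 - 1 / s \<le> ln s" using s by (simp add: ln_div)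
  then have "2 * s\<^sup>2 * (1 - 1 / s) \<le> 2 * s\<^sup>2 * ln s"
    by (intro mult_left_mono) auto
  moreover have "2 * s\<^sup>2 * (1 - 1 / s) = x - 1 + (s - 1)\<^sup>2"
    using s by (simp add: field_simps power2_eq_square)
  moreover have "2 * s\<^sup>2 * ln s = x * ln x"
    using s by (simp add: ln_realpow)
  ultimately show ?thesis using 1 by linarith
qed

text \<open>
  A pointwise lower bound for the Jensen--Shannon integrand that is comparable to the squared
  distance near bounded densities and still controls unbounded values of the estimate.
\<close>

definition discrepancy :: "real \<Rightarrow> real \<Rightarrow> real" where
  "discrepancy a b = (a - b)\<^sup>2 / (12 * (a + b))"

definition js_term :: "real \<Rightarrow> real \<Rightarrow> real" where
  "js_term a b = a * ln (a / ((a + b) / 2))"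

text \<open>The logarithmic bound at \<open>x = a / m\<close>, multiplied by the midpoint
  \<open>m\<close>. Its linear part \<open>(a - b) / 2\<close> is antisymmetric and disappears on
  symmetrising. The upper bound serves integrability and the boundedness of the divergence.\<close>

lemma js_term_bounds:
  assumes "0 \<le> a" "0 \<le> b"
  shows "(a - b) / 2 + discrepancy a b \<le> js_term a b" "js_term a b \<le> a"
proof -
  define m where "m = (a + b) / 2"
  have "(a - b) / 2 + discrepancy a b \<le> js_term a b \<and> js_term a b \<le> a"
  proof (cases "a = 0")
    case True
    then show ?thesis
      using assms by (cases "b = 0") (auto simp: js_term_def discrepancy_def power2_eq_square)
  next
    case False
    then have a: "0 < a" "0 < m" "a \<le> 2 * m" using assms by (auto simp: m_def)
    define x where "x = a / m"
    have x: "0 < x" "x \<le> 2" "a = m * x" using a by (auto simp: x_def field_simps)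
    have js: "js_term a b = m * (x * ln x)"
      using x(3) by (simp add: js_term_def x_def flip: m_def)
    have "m * (x - 1 + (x - 1)\<^sup>2 / 6) \<le> js_term a b"
      unfolding js using a x by (intro mult_left_mono ln_lower_quadratic) auto
    moreover have "m * (x - 1 + (x - 1)\<^sup>2 / 6) = (a - b) / 2 + discrepancy a b"
    proof -
      have b: "b = 2 * m - a" by (simp add: m_def field_simps)
      show ?thesis
        unfolding discrepancy_def b x(3) using a
        by (simp add: field_simps power2_eq_square)
    qed
    moreover have "ln x \<le> 1"
    proof -
      have "ln x \<le> x - 1" using x by (intro ln_le_minus_one)
      then show ?thesis using x by linarith
    qed
    then have "m * (x * ln x) \<le> m * (x * 1)" using a x by (intro mult_left_mono) auto
    then have "js_term a b \<le> a" using js x by simp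
    ultimately show ?thesis by simp
  qed
  then show "(a - b) / 2 + discrepancy a b \<le> js_term a b" "js_term a b \<le> a" by auto
qed

lemma discrepancy_nonneg: "0 \<le> a \<Longrightarrow> 0 \<le> b \<Longrightarrow> 0 \<le> discrepancy a b"
  by (simp add: discrepancy_def)

lemma discrepancy_commute: "discrepancy a b = discrepancy b a"
  by (simp add: discrepancy_def power2_commute add.commute)

lemma discrepancy_le:
  assumes "0 \<le> a" "0 \<le> b" shows "discrepancy a b \<le> a + b"
proof (cases "a + b = 0")
  case False
  then have pos: "0 < a + b" using assms by simp
  have "(a - b)\<^sup>2 \<le> (a + b)\<^sup>2"
    using assms by (intro abs_le_square_iff[THEN iffD1]) auto
  also have "\<dots> \<le> (a + b) * (12 * (a + b))"
    unfolding power2_eq_square using pos by (intro mult_left_mono) auto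
  finally show ?thesis using pos by (simp add: discrepancy_def divide_le_eq)
qed (simp add: discrepancy_def)

text \<open>A substitute for the triangle inequality with \<open>t\<close> unrestricted above. For
  \<open>t \<le> 4\<close> the denominators are at most 72 and the discrepancy is comparable to a
  squared distance; for larger \<open>t\<close> each term is at least 1/36, which outweighs
  \<open>(u - v)^2 / 144\<close> because \<open>u\<close> and \<open>v\<close> differ by at most
  2.\<close>

lemma discrepancy_pair:
  assumes "0 \<le> t" "0 < u" "u \<le> 2" "0 < v" "v \<le> 2"
  shows "(u - v)\<^sup>2 / 144 \<le> discrepancy t u + discrepancy t v"
proof (cases "t \<le> 4")
  case True
  have "(t - w)\<^sup>2 / 72 \<le> discrepancy t w" if "0 < w" "w \<le> 2" for w
    unfolding discrepancy_def using that True assms by (intro divide_left_mono) auto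
  from this[of u] this[of v]
  have "((t - u)\<^sup>2 + (t - v)\<^sup>2) / 72 \<le> discrepancy t u + discrepancy t v"
    using assms by (simp add: add_divide_distrib)
  moreover have "(u - v)\<^sup>2 \<le> 2 * ((t - u)\<^sup>2 + (t - v)\<^sup>2)"
    using zero_le_power2[of "(t - u) + (t - v)"] by (simp add: power2_eq_square algebra_simps)
  ultimately show ?thesis by simp
next
  case False
  have "1 / 36 \<le> discrepancy t w" if w: "0 < w" "w \<le> 2" for w
  proof -
    have "t / 2 \<le> t - w" using w False by simp
    then have "(t / 2)\<^sup>2 \<le> (t - w)\<^sup>2" using False by (intro power_mono) auto
    moreover have "12 * (t + w) \<le> 36 * (t / 2)\<^sup>2"
    proof -
      have "4 * t \<le> t * t" using False by (intro mult_right_mono) auto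
      then have "12 * t + 12 * w \<le> 9 * (t * t)" using w False by linarith
      then show ?thesis by (simp add: power2_eq_square)
    qed
    ultimately have "12 * (t + w) \<le> 36 * (t - w)\<^sup>2"
      by (meson mult_left_mono order_trans zero_le_numeral)
    then show ?thesis
      using w False by (simp add: discrepancy_def le_divide_eq)
  qed
  from this[of u] this[of v] have "1 / 18 \<le> discrepancy t u + discrepancy t v" using assms by simp
  moreover have "(u - v)\<^sup>2 \<le> 2\<^sup>2"
    using assms by (intro abs_le_square_iff[THEN iffD1]) auto
  ultimately show ?thesis by simp
qed

lemma prob_density_integral:
  assumes "prob_density p"
  shows "p \<in> borel_measurable cube_measure" "\<And>x. x \<in> unit_cube \<Longrightarrow> 0 \<le> p x"
    "integrable cube_measure p" "(\<integral>x. p x \<partial>cube_measure) = 1"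
proof -
  show p [measurable]: "p \<in> borel_measurable cube_measure" and nn: "\<And>x. x \<in> unit_cube \<Longrightarrow> 0 \<le> p x"
    using assms by (auto simp: prob_density_def)
  have AE: "AE x in cube_measure. 0 \<le> p x" using nn by (intro AE_I2) simp
  have 1: "(\<integral>\<^sup>+x. ennreal (p x) \<partial>cube_measure) = ennreal 1"
    using assms by (simp add: prob_density_def)
  show "integrable cube_measure p"
    using 1 by (intro integrableI_nn_integral_finite[OF p AE])
  show "(\<integral>x. p x \<partial>cube_measure) = 1"
    using 1 AE by (simp add: integral_eq_nn_integral)
qed

lemma KL_eq_integral:
  assumes p: "p \<in> borel_measurable cube_measure" "\<And>x. x \<in> unit_cube \<Longrightarrow> 0 \<le> p x"
    and q: "q \<in> borel_measurable cube_measure" "\<And>x. x \<in> unit_cube \<Longrightarrow> 0 \<le> q x"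
    and ac: "\<And>x. x \<in> unit_cube \<Longrightarrow> q x = 0 \<Longrightarrow> p x = 0"
  shows "KL p q = (\<integral>x. p x * ln (p x / q x) \<partial>cube_measure)"
proof -
  interpret prob_space "cube_measure :: (real^'a) measure" by (rule prob_space_cube)
  have "KL p q = (\<integral>x. p x * log (exp 1) (p x / q x) \<partial>cube_measure)"
    unfolding KL_def using assms by (intro KL_density_density) (auto intro!: AE_I2)
  then show ?thesis by (simp add: log_def)
qed

lemma JS_eq_integral:
  assumes p: "prob_density p" and q: "prob_density q"
  shows "integrable cube_measure (\<lambda>x. js_term (p x) (q x) + js_term (q x) (p x))"
    and "JS p q = (\<integral>x. (js_term (p x) (q x) + js_term (q x) (p x)) / 2 \<partial>cube_measure)"
proof -
  note P = prob_density_integral[OF p] and Q = prob_density_integral[OF q]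
  note [measurable] = P(1) Q(1)
  have int: "integrable cube_measure (\<lambda>x. js_term (f x) (g x))"
    if f: "prob_density f" and g: "prob_density g" for f g :: "real^'a \<Rightarrow> real"
  proof (rule Bochner_Integration.integrable_bound)
    note F = prob_density_integral[OF f] and G = prob_density_integral[OF g]
    note [measurable] = F(1) G(1)
    show "integrable cube_measure (\<lambda>x. f x + g x)" using F G by simp
    show "(\<lambda>x. js_term (f x) (g x)) \<in> borel_measurable cube_measure"
      unfolding js_term_def by measurable
    show "AE x in cube_measure. norm (js_term (f x) (g x)) \<le> norm (f x + g x)"
    proof (rule AE_I2)
      fix x :: "real^'a" assume "x \<in> space cube_measure"
      then have "0 \<le> f x" "0 \<le> g x" using F(2) G(2) by auto
      then show "norm (js_term (f x) (g x)) \<le> norm (f x + g x)"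
        using js_term_bounds[OF \<open>0 \<le> f x\<close> \<open>0 \<le> g x\<close>]
          discrepancy_nonneg[OF \<open>0 \<le> f x\<close> \<open>0 \<le> g x\<close>]
          \<open>0 \<le> f x\<close> \<open>0 \<le> g x\<close> by (simp add: abs_le_iff field_simps)
    qed
  qed
  show i: "integrable cube_measure (\<lambda>x. js_term (p x) (q x) + js_term (q x) (p x))"
    using int[OF p q] int[OF q p] by simp
  have pos: "p x = 0 \<and> q x = 0" if "x \<in> unit_cube" "(p x + q x) / 2 = 0" for x
    using P(2)[OF that(1)] Q(2)[OF that(1)] that(2) by simp
  have "KL p (\<lambda>x. (p x + q x) / 2) = (\<integral>x. js_term (p x) (q x) \<partial>cube_measure)"
    unfolding js_term_def using P Q pos by (intro KL_eq_integral) auto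
  moreover have "KL q (\<lambda>x. (p x + q x) / 2) = (\<integral>x. js_term (q x) (p x) \<partial>cube_measure)"
    unfolding js_term_def using P Q pos
    by (subst KL_eq_integral) (auto simp: add.commute)
  ultimately show "JS p q = (\<integral>x. (js_term (p x) (q x) + js_term (q x) (p x)) / 2 \<partial>cube_measure)"
    using int[OF p q] int[OF q p] by (simp add: JS_def add_divide_distrib)
qed

lemma JS_bounds:
  assumes p: "prob_density p" and q: "prob_density q"
  shows "integrable cube_measure (\<lambda>x. discrepancy (p x) (q x))"
    and "(\<integral>x. discrepancy (p x) (q x) \<partial>cube_measure) \<le> JS p q" "0 \<le> JS p q" "JS p q \<le> 1"
proof -
  note P = prob_density_integral[OF p] and Q = prob_density_integral[OF q]
  note [measurable] = P(1) Q(1)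
  have nn: "0 \<le> p x" "0 \<le> q x" if "x \<in> space cube_measure" for x
    using that P(2) Q(2) by auto
  have "(\<lambda>x. discrepancy (p x) (q x)) \<in> borel_measurable cube_measure"
    unfolding discrepancy_def by measurable
  then show i: "integrable cube_measure (\<lambda>x. discrepancy (p x) (q x))"
    by (rule Bochner_Integration.integrable_bound[OF Bochner_Integration.integrable_add[OF P(3) Q(3)]])
       (use nn discrepancy_nonneg discrepancy_le in \<open>auto intro!: AE_I2\<close>)
  show le: "(\<integral>x. discrepancy (p x) (q x) \<partial>cube_measure) \<le> JS p q"
    unfolding JS_eq_integral(2)[OF p q]
  proof (rule integral_mono[OF i])
    show "integrable cube_measure (\<lambda>x. (js_term (p x) (q x) + js_term (q x) (p x)) / 2)"
      using JS_eq_integral(1)[OF p q] by simp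
    fix x assume "x \<in> space (cube_measure :: (real^'a) measure)"
    note nn = nn[OF this]
    \<comment> \<open>The linear parts cancel in the sum, leaving the average of two equal
      discrepancies.\<close>
    show "discrepancy (p x) (q x) \<le> (js_term (p x) (q x) + js_term (q x) (p x)) / 2"
      using js_term_bounds(1)[OF nn] js_term_bounds(1)[OF nn(2,1)]
        discrepancy_commute[of "p x" "q x"] by (simp add: field_simps)
  qed
  have "0 \<le> (\<integral>x. discrepancy (p x) (q x) \<partial>cube_measure)"
    using nn by (intro integral_nonneg_AE AE_I2 discrepancy_nonneg)
  with le show "0 \<le> JS p q" by simp
  have "JS p q \<le> (\<integral>x. (p x + q x) / 2 \<partial>cube_measure)"
    unfolding JS_eq_integral(2)[OF p q]
    using JS_eq_integral(1)[OF p q] P Q nn js_term_bounds(2)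
    by (intro integral_mono) (auto intro!: add_mono divide_right_mono)
  then show "JS p q \<le> 1" using P Q by simp
qed

section \<open>Two-point bound\<close>

lemma prob_space_density_cube:
  fixes p :: "real^'d::finite \<Rightarrow> real"
  assumes p: "prob_density p"
  shows "prob_space (density cube_measure (\<lambda>x. ennreal (p x)))"
proof (rule prob_spaceI)
  let ?M = "cube_measure :: (real^'d) measure"
  have "emeasure (density ?M (\<lambda>x. ennreal (p x))) (space ?M) = (\<integral>\<^sup>+x\<in>space ?M. ennreal (p x) \<partial>?M)"
    using prob_density_integral(1)[OF p] by (intro emeasure_density sets.top) simp
  also have "\<dots> = (\<integral>\<^sup>+x. ennreal (p x) \<partial>?M)"
    by (intro nn_integral_cong) (simp del: space_restrict_space2)
  also have "\<dots> = 1" using p by (simp add: prob_density_def)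
  finally show "emeasure (density ?M (\<lambda>x. ennreal (p x))) (space (density ?M (\<lambda>x. ennreal (p x)))) = 1"
    by simp
qed

text \<open>Measurable rectangles determine the product measure, and on them the product of
  densities integrates factor by factor.\<close>

lemma sample_law_eq_density:
  fixes p :: "real^'d::finite \<Rightarrow> real"
  assumes p: "prob_density p"
  shows "sample_law n p = density (\<Pi>\<^sub>M k\<in>{..<n}. cube_measure) (\<lambda>X. \<Prod>k<n. ennreal (p (X k)))"
proof -
  let ?M = "cube_measure :: (real^'d) measure"
  let ?D = "density ?M (\<lambda>x. ennreal (p x))"
  note [measurable] = prob_density_integral(1)[OF p]
  interpret D: prob_space ?D by (rule prob_space_density_cube[OF p])
  interpret M: prob_space ?M by (rule prob_space_cube)
  interpret PD: product_sigma_finite "\<lambda>k::nat. ?D" by standard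
  interpret PM: product_sigma_finite "\<lambda>k::nat. ?M" by standard
  have meas: "(\<lambda>X. \<Prod>k<n. ennreal (p (X k))) \<in> borel_measurable (\<Pi>\<^sub>M k\<in>{..<n}. ?M)"
    by measurable
  have "density (\<Pi>\<^sub>M k\<in>{..<n}. ?M) (\<lambda>X. \<Prod>k<n. ennreal (p (X k))) = (\<Pi>\<^sub>M k\<in>{..<n}. ?D)"
  proof (rule PD.PiM_eqI)
    show "sets (density (\<Pi>\<^sub>M k\<in>{..<n}. ?M) (\<lambda>X. \<Prod>k<n. ennreal (p (X k)))) = sets (\<Pi>\<^sub>M k\<in>{..<n}. ?D)"
      by (simp cong: sets_PiM_cong)
    fix B :: "nat \<Rightarrow> (real^'d) set" assume B: "\<And>i. i \<in> {..<n} \<Longrightarrow> B i \<in> sets ?D"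
    then have B': "\<And>i. i \<in> {..<n} \<Longrightarrow> B i \<in> sets ?M" by simp
    have "emeasure (density (\<Pi>\<^sub>M k\<in>{..<n}. ?M) (\<lambda>X. \<Prod>k<n. ennreal (p (X k)))) (Pi\<^sub>E {..<n} B)
        = (\<integral>\<^sup>+X. (\<Prod>k<n. ennreal (p (X k))) * indicator (Pi\<^sub>E {..<n} B) X \<partial>(\<Pi>\<^sub>M k\<in>{..<n}. ?M))"
      using B' by (intro emeasure_density meas sets_PiM_I_finite) auto
    also have "\<dots> = (\<integral>\<^sup>+X. (\<Prod>k<n. ennreal (p (X k)) * indicator (B k) (X k)) \<partial>(\<Pi>\<^sub>M k\<in>{..<n}. ?M))"
    proof (intro nn_integral_cong)
      fix X assume "X \<in> space (\<Pi>\<^sub>M k\<in>{..<n}. ?M)"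
      then have "X \<in> extensional {..<n}" by (simp add: space_PiM PiE_def)
      then have "indicator (Pi\<^sub>E {..<n} B) X = (\<Prod>k<n. indicator (B k) (X k) :: ennreal)"
        by (auto simp: indicator_def PiE_def Pi_def)
      then show "(\<Prod>k<n. ennreal (p (X k))) * indicator (Pi\<^sub>E {..<n} B) X
          = (\<Prod>k<n. ennreal (p (X k)) * indicator (B k) (X k))"
        by (simp add: prod.distrib)
    qed
    also have "\<dots> = (\<Prod>k<n. \<integral>\<^sup>+x. ennreal (p x) * indicator (B k) x \<partial>?M)"
      using B' by (intro PM.product_nn_integral_prod) auto
    also have "\<dots> = (\<Prod>k<n. emeasure ?D (B k))"
      using B' by (intro prod.cong) (auto simp: emeasure_density)
    finally show "emeasure (density (\<Pi>\<^sub>M k\<in>{..<n}. ?M) (\<lambda>X. \<Prod>k<n. ennreal (p (X k)))) (Pi\<^sub>E {..<n} B)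
        = (\<Prod>i<n. emeasure ?D (B i))" .
  qed simp
  then show ?thesis by (simp add: sample_law_def)
qed

lemma prob_space_sample_law:
  assumes "prob_density p"
  shows "prob_space (sample_law n p)"
  unfolding sample_law_def using prob_space_density_cube[OF assms] by (intro prob_space_PiM)

lemma sets_sample_law: "sets (sample_law n p) = sets (\<Pi>\<^sub>M k\<in>{..<n}. cube_measure)"
  unfolding sample_law_def by (intro sets_PiM_cong) auto

lemma space_sample_law: "space (sample_law n p) = space (\<Pi>\<^sub>M k\<in>{..<n}. cube_measure)"
  by (rule sets_eq_imp_space_eq[OF sets_sample_law])

text \<open>Le Cam's two-point method: \<open>f0\<close> and \<open>f1\<close> are losses that
  cannot both be small at the same sample. The integral of \<open>p1^2 / p0\<close> is one plus the
  chi-square divergence of a single observation, and its \<open>n\<close>-th power the same quantity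
  for the whole sample. The bound has content as long as this power stays below 4.\<close>

lemma two_point_bound:
  fixes p0 p1 :: "real^'d::finite \<Rightarrow> real"
  assumes p0: "prob_density p0" and p1: "prob_density p1" and pos: "\<And>x. x \<in> unit_cube \<Longrightarrow> 0 < p0 x"
    and chi: "integrable cube_measure (\<lambda>x. (p1 x)\<^sup>2 / p0 x)"
    and f0: "f0 \<in> borel_measurable (\<Pi>\<^sub>M k\<in>{..<n}. cube_measure)"
    and f1: "f1 \<in> borel_measurable (\<Pi>\<^sub>M k\<in>{..<n}. cube_measure)"
    and b0: "\<And>X. X \<in> space (\<Pi>\<^sub>M k\<in>{..<n}. cube_measure) \<Longrightarrow> 0 \<le> f0 X \<and> f0 X \<le> 1"
    and b1: "\<And>X. X \<in> space (\<Pi>\<^sub>M k\<in>{..<n}. cube_measure) \<Longrightarrow> 0 \<le> f1 X \<and> f1 X \<le> 1"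
    and \<sigma>: "0 \<le> \<sigma>" "\<And>X. X \<in> space (\<Pi>\<^sub>M k\<in>{..<n}. cube_measure) \<Longrightarrow> \<sigma> \<le> f0 X + f1 X"
  shows "\<sigma> * (1 - (\<integral>x. (p1 x)\<^sup>2 / p0 x \<partial>cube_measure) ^ n / 4)
    \<le> (\<integral>X. f0 X \<partial>sample_law n p0) + (\<integral>X. f1 X \<partial>sample_law n p1)"
proof -
  let ?M = "cube_measure :: (real^'d) measure"
  let ?\<mu> = "\<Pi>\<^sub>M k\<in>{..<n}. ?M"
  interpret M: prob_space ?M by (rule prob_space_cube)
  interpret PM: product_sigma_finite "\<lambda>k::nat. ?M" by standard
  note P0 = prob_density_integral[OF p0] and P1 = prob_density_integral[OF p1]
  note [measurable] = P0(1) P1(1) f0 f1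
  define P Q where "P X = (\<Prod>k<n. p0 (X k))" and "Q X = (\<Prod>k<n. p1 (X k))" for X
  have X: "X k \<in> unit_cube" if "X \<in> space ?\<mu>" "k < n" for X k
    using that by (auto simp: space_PiM PiE_def)
  have Ppos: "0 < P X" if "X \<in> space ?\<mu>" for X
    unfolding P_def using X[OF that] pos by (intro prod_pos) auto
  have Qnn: "0 \<le> Q X" if "X \<in> space ?\<mu>" for X
    unfolding Q_def using X[OF that] P1(2) by (intro prod_nonneg) auto
  have [measurable]: "P \<in> borel_measurable ?\<mu>" "Q \<in> borel_measurable ?\<mu>"
    unfolding P_def Q_def by measurable
  have iP: "integrable ?\<mu> P" unfolding P_def using P0(3) by (intro PM.product_integrable_prod) auto
  have iQ: "integrable ?\<mu> Q" unfolding Q_def using P1(3) by (intro PM.product_integrable_prod) auto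
  have Q1: "(\<integral>X. Q X \<partial>?\<mu>) = 1"
    unfolding Q_def using P1 by (subst PM.product_integral_prod) auto
  define Z where "Z X = (Q X)\<^sup>2 / P X" for X
  have QP: "Z X = (\<Prod>k<n. (p1 (X k))\<^sup>2 / p0 (X k))" for X
    by (simp add: Z_def P_def Q_def prod_dividef prod_power_distrib)
  have iR: "integrable ?\<mu> Z"
    unfolding QP using chi by (intro PM.product_integrable_prod) auto
  have R: "(\<integral>X. Z X \<partial>?\<mu>) = (\<integral>x. (p1 x)\<^sup>2 / p0 x \<partial>?M) ^ n"
    unfolding QP using chi by (subst PM.product_integral_prod) auto
  have law0: "sample_law n p0 = density ?\<mu> (\<lambda>X. ennreal (P X))"
    unfolding sample_law_eq_density[OF p0]
    by (intro density_cong AE_I2) (use X P0(2) in \<open>auto simp: P_def intro!: prod_ennreal\<close>)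
  have law1: "sample_law n p1 = density ?\<mu> (\<lambda>X. ennreal (Q X))"
    unfolding sample_law_eq_density[OF p1]
    by (intro density_cong AE_I2) (use X P1(2) in \<open>auto simp: Q_def intro!: prod_ennreal\<close>)
  have e0: "(\<integral>X. f0 X \<partial>sample_law n p0) = (\<integral>X. P X * f0 X \<partial>?\<mu>)"
    unfolding law0 using Ppos by (intro integral_real_density) (auto intro!: AE_I2 less_imp_le)
  have e1: "(\<integral>X. f1 X \<partial>sample_law n p1) = (\<integral>X. Q X * f1 X \<partial>?\<mu>)"
    unfolding law1 using Qnn by (intro integral_real_density) (auto intro!: AE_I2)
  have i0: "integrable ?\<mu> (\<lambda>X. P X * f0 X)"
    by (rule Bochner_Integration.integrable_bound[OF iP])
       (use b0 Ppos in \<open>auto intro!: AE_I2 mult_left_le simp: abs_mult\<close>)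
  have i1: "integrable ?\<mu> (\<lambda>X. Q X * f1 X)"
    by (rule Bochner_Integration.integrable_bound[OF iQ])
       (use b1 Qnn in \<open>auto intro!: AE_I2 mult_left_le simp: abs_mult\<close>)
  have "\<sigma> * (1 - (\<integral>x. (p1 x)\<^sup>2 / p0 x \<partial>?M) ^ n / 4) = (\<integral>X. \<sigma> * (Q X - Z X / 4) \<partial>?\<mu>)"
    using iQ iR by (simp add: Q1 R)
  also have "\<dots> \<le> (\<integral>X. P X * f0 X + Q X * f1 X \<partial>?\<mu>)"
  proof (rule integral_mono)
    show "integrable ?\<mu> (\<lambda>X. \<sigma> * (Q X - Z X / 4))" using iQ iR by simp
    show "integrable ?\<mu> (\<lambda>X. P X * f0 X + Q X * f1 X)" using i0 i1 by simp
    fix X assume X: "X \<in> space ?\<mu>"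
    \<comment> \<open>With \<open>L = Q X / P X\<close> this is \<open>L - L\<^sup>2 / 4 \<le> min 1 L\<close>, which turns the affinity into a
      chi-square distance and so tensorises.\<close>
    have *: "Q X - Z X / 4 \<le> min (P X) (Q X)"
    proof -
      have "0 \<le> (Q X / 2 - P X)\<^sup>2 / P X" using Ppos[OF X] by simp
      also have "\<dots> = P X - (Q X - Z X / 4)"
        using Ppos[OF X] by (simp add: Z_def field_simps power2_eq_square)
      finally have "Q X - Z X / 4 \<le> P X" by simp
      moreover have "0 \<le> Z X" using Ppos[OF X] by (simp add: Z_def)
      ultimately show ?thesis by simp
    qed
    have "\<sigma> * (Q X - Z X / 4) \<le> \<sigma> * min (P X) (Q X)"
      using \<sigma>(1) * by (intro mult_left_mono)
    also have "\<dots> \<le> (f0 X + f1 X) * min (P X) (Q X)"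
      using \<sigma>(2)[OF X] Ppos[OF X] Qnn[OF X] by (intro mult_right_mono) auto
    also have "\<dots> = f0 X * min (P X) (Q X) + f1 X * min (P X) (Q X)"
      by (simp add: distrib_right)
    also have "\<dots> \<le> f0 X * P X + f1 X * Q X"
      using b0[OF X] b1[OF X] by (intro add_mono mult_left_mono) auto
    finally show "\<sigma> * (Q X - Z X / 4) \<le> P X * f0 X + Q X * f1 X"
      by (simp add: mult.commute)
  qed
  also have "\<dots> = (\<integral>X. P X * f0 X \<partial>?\<mu>) + (\<integral>X. Q X * f1 X \<partial>?\<mu>)"
    using i0 i1 by simp
  finally show ?thesis by (simp add: e0 e1)
qed

section \<open>Averaging over the hypercube\<close>

text \<open>For each \<open>k\<close> the vertices of the cube \<open>Pow K\<close> pair off as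
  \<open>\<theta>\<close> and \<open>insert k \<theta>\<close>, so the average over all vertices of
  \<open>R k\<close> is at least \<open>g / 2\<close>. Some vertex does at least as well as the
  average of the sum over \<open>k\<close>.\<close>

lemma hypercube_average:
  fixes R :: "'a \<Rightarrow> 'a set \<Rightarrow> real"
  assumes K: "finite K"
    and pair: "\<And>k \<theta>. k \<in> K \<Longrightarrow> \<theta> \<subseteq> K - {k} \<Longrightarrow> g \<le> R k \<theta> + R k (insert k \<theta>)"
  shows "\<exists>\<theta>\<subseteq>K. card K * (g / 2) \<le> (\<Sum>k\<in>K. R k \<theta>)"
proof (rule ccontr)
  assume "\<not> ?thesis"
  then have less: "(\<Sum>k\<in>K. R k \<theta>) < card K * (g / 2)" if "\<theta> \<in> Pow K" for \<theta>
    using that by (auto simp: not_le)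
  have half: "2 ^ card K * (g / 2) \<le> (\<Sum>\<theta>\<in>Pow K. R k \<theta>)" if k: "k \<in> K" for k
  proof -
    have "Pow K = Pow (K - {k}) \<union> insert k ` Pow (K - {k})"
      using Pow_insert[of k "K - {k}"] k by (simp add: insert_absorb)
    moreover have "Pow (K - {k}) \<inter> insert k ` Pow (K - {k}) = {}" by auto
    moreover have "inj_on (insert k) (Pow (K - {k}))"
      by (auto simp: inj_on_def)
    ultimately have "(\<Sum>\<theta>\<in>Pow K. R k \<theta>)
        = (\<Sum>\<theta>\<in>Pow (K - {k}). R k \<theta>) + (\<Sum>\<theta>\<in>Pow (K - {k}). R k (insert k \<theta>))"
      using K by (simp add: sum.union_disjoint sum.reindex)
    also have "\<dots> = (\<Sum>\<theta>\<in>Pow (K - {k}). R k \<theta> + R k (insert k \<theta>))"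
      by (simp add: sum.distrib)
    also have "\<dots> \<ge> (\<Sum>\<theta>\<in>Pow (K - {k}). g)"
      using pair[OF k] by (intro sum_mono) auto
    finally have "2 ^ (card K - 1) * g \<le> (\<Sum>\<theta>\<in>Pow K. R k \<theta>)"
      using K k by (simp add: card_Pow)
    moreover have "card K = Suc (card K - 1)" using K k by (simp add: card_gt_0_iff Suc_diff_1 ex_in_conv[symmetric] exI)
    then have "(2::real) ^ card K = 2 * 2 ^ (card K - 1)" by (metis power_Suc)
    ultimately show ?thesis by simp
  qed
  have "(\<Sum>\<theta>\<in>Pow K. \<Sum>k\<in>K. R k \<theta>) < (\<Sum>\<theta>\<in>Pow K. card K * (g / 2))"
    using K less by (intro sum_strict_mono) auto
  also have "\<dots> = (\<Sum>k\<in>K. 2 ^ card K * (g / 2))"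
    using K by (simp add: card_Pow)
  also have "\<dots> \<le> (\<Sum>k\<in>K. \<Sum>\<theta>\<in>Pow K. R k \<theta>)"
    by (intro sum_mono half)
  also have "\<dots> = (\<Sum>\<theta>\<in>Pow K. \<Sum>k\<in>K. R k \<theta>)"
    by (rule sum.swap)
  finally show False by simp
qed

section \<open>Assouad's bound for a fixed estimate\<close>

locale shift_estimation = shift_map m A e for m A and e :: "'d::finite" +
  fixes n :: nat and q :: "(nat \<Rightarrow> real^'d) \<Rightarrow> real^'d \<Rightarrow> real"
  assumes estimate: "density_estimate n q"
    and gap_le: "\<And>k. k \<in> grid m \<Longrightarrow> n * gap k \<le> 1"
begin

abbreviation samples :: "(nat \<Rightarrow> real^'d) measure" where
  "samples \<equiv> \<Pi>\<^sub>M k\<in>{..<n}. cube_measure"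

text \<open>The share of cell \<open>k\<close> in the lower bound for the divergence. For finite
  \<open>\<theta>\<close> it depends on \<open>\<theta>\<close> only through whether
  \<open>k\<close> belongs to it.\<close>

definition loss :: "('d \<Rightarrow> nat) \<Rightarrow> ('d \<Rightarrow> nat) set \<Rightarrow> (nat \<Rightarrow> real^'d) \<Rightarrow> real" where
  "loss k \<theta> X = (\<integral>x. indicator (cell m k) x * discrepancy (q X x) (dens \<theta> x) \<partial>cube_measure)"

sublocale M: prob_space "cube_measure :: (real^'d) measure"
  by (rule prob_space_cube)

lemma q_measurable [measurable]:
  "(\<lambda>z. q (fst z) (snd z)) \<in> borel_measurable (samples \<Otimes>\<^sub>M cube_measure)"
  using estimate by (simp add: density_estimate_def split_beta')

lemma q_density: "X \<in> space samples \<Longrightarrow> prob_density (q X)"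
  using estimate by (simp add: density_estimate_def)

lemma cell_measurable [measurable]: "indicator (cell m k) \<in> borel_measurable cube_measure"
  by (intro measurable_restrict_space1 borel_measurable_indicator) (simp add: borel_open[OF open_cell])

lemma loss_measurable [measurable]: "loss k \<theta> \<in> borel_measurable samples"
proof -
  have [measurable]: "(\<lambda>z. dens \<theta> (snd z)) \<in> borel_measurable (samples \<Otimes>\<^sub>M cube_measure)"
    by (rule measurable_compose[OF measurable_snd dens_measurable])
  have ind: "(\<lambda>z. indicator (cell m k) (snd z) :: real) \<in> borel_measurable (samples \<Otimes>\<^sub>M cube_measure)"
    by (rule measurable_compose[OF measurable_snd cell_measurable])
  have "(\<lambda>z. discrepancy (q (fst z) (snd z)) (dens \<theta> (snd z)))
      \<in> borel_measurable (samples \<Otimes>\<^sub>M cube_measure)"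
    unfolding discrepancy_def by measurable
  then have "(\<lambda>z. indicator (cell m k) (snd z) * discrepancy (q (fst z) (snd z)) (dens \<theta> (snd z)))
      \<in> borel_measurable (samples \<Otimes>\<^sub>M cube_measure)"
    by (rule borel_measurable_times[OF ind])
  then show ?thesis
    unfolding loss_def[abs_def] by (intro M.borel_measurable_lebesgue_integral) (simp add: split_beta')
qed

lemma JS_measurable: "(\<lambda>X. JS (q X) (dens \<theta>)) \<in> borel_measurable samples"
proof -
  have [measurable]: "(\<lambda>z. dens \<theta> (snd z)) \<in> borel_measurable (samples \<Otimes>\<^sub>M cube_measure)"
    by (rule measurable_compose[OF measurable_snd dens_measurable])
  have "(\<lambda>X. \<integral>x. (js_term (q X x) (dens \<theta> x) + js_term (dens \<theta> x) (q X x)) / 2 \<partial>cube_measure)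
      \<in> borel_measurable samples"
    unfolding js_term_def by (intro M.borel_measurable_lebesgue_integral) measurable
  then show ?thesis
    by (subst measurable_cong[OF JS_eq_integral(2)[OF q_density prob_density_dens]])
qed

lemma loss_integrable:
  assumes X: "X \<in> space samples"
  shows "integrable cube_measure (\<lambda>x. indicator (cell m k) x * discrepancy (q X x) (dens \<theta> x))"
proof -
  note J = JS_bounds(1)[OF q_density[OF X] prob_density_dens[of \<theta>]]
  have "(\<lambda>x. indicator (cell m k) x * discrepancy (q X x) (dens \<theta> x)) \<in> borel_measurable cube_measure"
    by (intro borel_measurable_times cell_measurable borel_measurable_integrable[OF J])
  from Bochner_Integration.integrable_bound[OF J this] show ?thesis
    by (auto simp: abs_mult indicator_def)
qed

lemma discrepancy_q_nonneg:
  assumes "X \<in> space samples" "x \<in> unit_cube"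
  shows "0 \<le> discrepancy (q X x) (dens \<theta> x)"
  using prob_density_integral(2)[OF q_density[OF assms(1)] assms(2)] dens_bounds(1)[of \<theta> x]
  by (intro discrepancy_nonneg) auto

lemma loss_nonneg: "X \<in> space samples \<Longrightarrow> 0 \<le> loss k \<theta> X"
  unfolding loss_def by (intro integral_nonneg_AE AE_I2 mult_nonneg_nonneg discrepancy_q_nonneg) auto

text \<open>The cells are disjoint and the discrepancy is nonnegative, so the localised losses add
  up to at most the full integral.\<close>

lemma sum_loss_le_JS:
  assumes X: "X \<in> space samples"
  shows "(\<Sum>k\<in>grid m. loss k \<theta> X) \<le> JS (q X) (dens \<theta>)"
proof -
  have "(\<Sum>k\<in>grid m. loss k \<theta> X)
      = (\<integral>x. (\<Sum>k\<in>grid m. indicator (cell m k) x * discrepancy (q X x) (dens \<theta> x)) \<partial>cube_measure)"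
    unfolding loss_def using loss_integrable[OF X] by (subst Bochner_Integration.integral_sum) auto
  also have "\<dots> \<le> (\<integral>x. discrepancy (q X x) (dens \<theta> x) \<partial>cube_measure)"
  proof (rule integral_mono)
    fix x assume "x \<in> space (cube_measure :: (real^'d) measure)"
    then have nn: "0 \<le> discrepancy (q X x) (dens \<theta> x)"
      using discrepancy_q_nonneg[OF X] by simp
    have "(\<Sum>k\<in>grid m. indicator (cell m k) x) \<le> (1::real)"
    proof (cases "\<exists>k\<in>grid m. x \<in> cell m k")
      case True
      then obtain k where k: "k \<in> grid m" "x \<in> cell m k" by blast
      have "indicator (cell m k') x = (if k' = k then 1 else (0::real))" for k'
        using cell_unique[OF k(2), of k'] k(2) by (cases "x \<in> cell m k'") auto
      then show ?thesis using k(1) by (simp add: finite_grid)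
    qed (auto simp: indicator_def intro: sum_nonpos)
    from mult_right_mono[OF this nn]
    show "(\<Sum>k\<in>grid m. indicator (cell m k) x * discrepancy (q X x) (dens \<theta> x))
        \<le> discrepancy (q X x) (dens \<theta> x)"
      by (simp only: sum_distrib_right mult_1)
  qed (use loss_integrable[OF X] JS_bounds(1)[OF q_density[OF X] prob_density_dens] in auto)
  also have "\<dots> \<le> JS (q X) (dens \<theta>)"
    by (rule JS_bounds(2)[OF q_density[OF X] prob_density_dens])
  finally show ?thesis .
qed

lemma loss_le_1:
  assumes "X \<in> space samples" "k \<in> grid m"
  shows "loss k \<theta> X \<le> 1"
proof -
  have "loss k \<theta> X \<le> (\<Sum>k\<in>grid m. loss k \<theta> X)"
    using assms loss_nonneg finite_grid by (intro member_le_sum) auto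
  also have "\<dots> \<le> 1"
    using sum_loss_le_JS[OF assms(1)] JS_bounds(4)[OF q_density[OF assms(1)] prob_density_dens]
    by (rule order_trans)
  finally show ?thesis .
qed

lemma sum_loss_le_risk:
  "(\<Sum>k\<in>grid m. \<integral>X. loss k \<theta> X \<partial>sample_law n (dens \<theta>)) \<le> JS_risk n q (dens \<theta>)"
proof -
  interpret S: prob_space "sample_law n (dens \<theta>)"
    by (rule prob_space_sample_law[OF prob_density_dens])
  have meas: "f \<in> borel_measurable (sample_law n (dens \<theta>))" if "f \<in> borel_measurable samples"
    for f :: "_ \<Rightarrow> real"
    using that measurable_cong_sets[OF sets_sample_law[of n "dens \<theta>"] refl] by blast
  have space: "space (sample_law n (dens \<theta>)) = space samples"
    by (rule space_sample_law)
  have i: "integrable (sample_law n (dens \<theta>)) (loss k \<theta>)" if "k \<in> grid m" for k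
    using loss_nonneg loss_le_1[OF _ that]
    by (intro S.integrable_const_bound[where B=1] AE_I2 meas loss_measurable) (auto simp: space)
  have j: "integrable (sample_law n (dens \<theta>)) (\<lambda>X. JS (q X) (dens \<theta>))"
    using JS_bounds(3,4)[OF q_density prob_density_dens]
    by (intro S.integrable_const_bound[where B=1] AE_I2 meas JS_measurable) (auto simp: space)
  have "(\<Sum>k\<in>grid m. \<integral>X. loss k \<theta> X \<partial>sample_law n (dens \<theta>))
      = (\<integral>X. (\<Sum>k\<in>grid m. loss k \<theta> X) \<partial>sample_law n (dens \<theta>))"
    using i by (subst Bochner_Integration.integral_sum) auto
  also have "\<dots> \<le> (\<integral>X. JS (q X) (dens \<theta>) \<partial>sample_law n (dens \<theta>))"
    using i j sum_loss_le_JS by (intro integral_mono) (auto simp: space)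
  finally show ?thesis by (simp add: JS_risk_def)
qed

lemma gap_integrable: "integrable cube_measure (\<lambda>x. indicator (cell m k) x * (dens {k} x - 1)\<^sup>2)"
proof (rule M.integrable_const_bound[where B=1])
  show "AE x in cube_measure. norm (indicator (cell m k) x * (dens {k} x - 1)\<^sup>2) \<le> 1"
  proof (rule AE_I2)
    fix x
    have "\<bar>dens {k} x - 1\<bar> \<le> 1" using dens_bounds[of "{k}" x] by (simp add: abs_le_iff)
    then have "(dens {k} x - 1)\<^sup>2 \<le> 1" by (simp add: abs_square_le_1)
    then show "norm (indicator (cell m k) x * (dens {k} x - 1)\<^sup>2) \<le> 1"
      by (simp add: indicator_def)
  qed
qed measurable

text \<open>On cell \<open>k\<close> the two candidates are the constant 1 and
  \<open>dens {k}\<close>, while the estimate is the same for both; \<open>discrepancy_pair\<close>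
  applies pointwise.\<close>

lemma loss_pair:
  assumes X: "X \<in> space samples" and k: "k \<in> grid m" and \<theta>: "\<theta> \<subseteq> grid m - {k}"
  shows "gap k / 144 \<le> loss k \<theta> X + loss k (insert k \<theta>) X"
proof -
  have fin: "finite \<theta>" using \<theta> finite_grid finite_subset by blast
  have "gap k / 144 = (\<integral>x. indicator (cell m k) x * (dens {k} x - 1)\<^sup>2 / 144 \<partial>cube_measure)"
    by (simp add: gap_def)
  also have "\<dots> \<le> (\<integral>x. indicator (cell m k) x * discrepancy (q X x) (dens \<theta> x)
      + indicator (cell m k) x * discrepancy (q X x) (dens (insert k \<theta>) x) \<partial>cube_measure)"
  proof (rule integral_mono)
    fix x assume "x \<in> space (cube_measure :: (real^'d) measure)"
    then have x: "x \<in> unit_cube" by simp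
    show "indicator (cell m k) x * (dens {k} x - 1)\<^sup>2 / 144
        \<le> indicator (cell m k) x * discrepancy (q X x) (dens \<theta> x)
         + indicator (cell m k) x * discrepancy (q X x) (dens (insert k \<theta>) x)"
    proof (cases "x \<in> cell m k")
      case True
      have 1: "dens \<theta> x = 1"
        using dens_in_cell[OF x True fin, of "{}"] \<theta> dens_empty[OF x] by auto
      have 2: "dens (insert k \<theta>) x = dens {k} x"
        using fin by (intro dens_in_cell[OF x True]) auto
      have "(1 - dens {k} x)\<^sup>2 / 144 \<le> discrepancy (q X x) 1 + discrepancy (q X x) (dens {k} x)"
        using prob_density_integral(2)[OF q_density[OF X] x] dens_bounds[of "{k}" x]
        by (intro discrepancy_pair) auto
      then show ?thesis using True by (simp add: 1 2 power2_commute)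
    qed simp
  qed (use gap_integrable loss_integrable[OF X] in auto)
  also have "\<dots> = loss k \<theta> X + loss k (insert k \<theta>) X"
    unfolding loss_def using loss_integrable[OF X] by simp
  finally show ?thesis .
qed

text \<open>Inside the cell the reference density is 1 and
  \<open>p^2 = 2 * p - 1 + (p - 1)^2\<close>; outside both densities agree and
  \<open>p^2 / p = 2 * p - p\<close>. The common form integrates to
  \<open>2 - 1 + gap k\<close>.\<close>

lemma chi_square_gap:
  assumes k: "k \<in> grid m" and \<theta>: "\<theta> \<subseteq> grid m - {k}"
  shows "integrable cube_measure (\<lambda>x. (dens (insert k \<theta>) x)\<^sup>2 / dens \<theta> x)"
    and "(\<integral>x. (dens (insert k \<theta>) x)\<^sup>2 / dens \<theta> x \<partial>cube_measure) = 1 + gap k"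
proof -
  have fin: "finite \<theta>" using \<theta> finite_grid finite_subset by blast
  have eq: "(dens (insert k \<theta>) x)\<^sup>2 / dens \<theta> x
      = 2 * dens (insert k \<theta>) x - dens \<theta> x + indicator (cell m k) x * (dens {k} x - 1)\<^sup>2"
    if "x \<in> space (cube_measure :: (real^'d) measure)" for x
  proof (cases "x \<in> cell m k")
    case True
    have x: "x \<in> unit_cube" using that by simp
    have "dens \<theta> x = 1"
      using dens_in_cell[OF x True fin, of "{}"] \<theta> dens_empty[OF x] by auto
    moreover have "dens (insert k \<theta>) x = dens {k} x"
      using fin by (intro dens_in_cell[OF x True]) auto
    ultimately show ?thesis using True by (simp add: power2_eq_square algebra_simps)
  next
    case False
    then have "dens (insert k \<theta>) x = dens \<theta> x"
      using that fin by (intro dens_insert) auto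
    moreover have "0 < dens \<theta> x" using dens_bounds(1)[of \<theta> x] by linarith
    ultimately show ?thesis using False by (simp add: power2_eq_square)
  qed
  note D = prob_density_integral[OF prob_density_dens]
  show "integrable cube_measure (\<lambda>x. (dens (insert k \<theta>) x)\<^sup>2 / dens \<theta> x)"
    using D(3) gap_integrable by (subst Bochner_Integration.integrable_cong[OF refl eq]) auto
  show "(\<integral>x. (dens (insert k \<theta>) x)\<^sup>2 / dens \<theta> x \<partial>cube_measure) = 1 + gap k"
    using D(3,4) gap_integrable
    by (subst Bochner_Integration.integral_cong[OF refl eq]) (auto simp: gap_def)
qed

lemma expected_loss_pair:
  assumes k: "k \<in> grid m" and \<theta>: "\<theta> \<subseteq> grid m - {k}"
  shows "gap k / 576 \<le> (\<integral>X. loss k \<theta> X \<partial>sample_law n (dens \<theta>))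
    + (\<integral>X. loss k (insert k \<theta>) X \<partial>sample_law n (dens (insert k \<theta>)))"
proof -
  have g0: "0 \<le> gap k"
    unfolding gap_def by (intro integral_nonneg_AE AE_I2) auto
  \<comment> \<open>Since \<open>n * gap k \<le> 1\<close>, the power is at most
    \<open>exp 1 \<le> 3\<close>, which leaves the factor 1/4 in the two-point bound; hence 576 = 4
    * 144.\<close>
  have "(1 + gap k) ^ n \<le> exp (gap k) ^ n"
    using g0 by (intro power_mono exp_ge_add_one_self) auto
  also have "\<dots> = exp (n * gap k)" by (simp add: exp_of_nat_mult)
  also have "\<dots> \<le> exp 1" using gap_le[OF k] by simp
  also have "\<dots> \<le> 3" by (rule exp_le)
  finally have "(1::real) / 4 \<le> 1 - (1 + gap k) ^ n / 4" by simp
  then have "gap k / 144 * (1 / 4) \<le> gap k / 144 * (1 - (1 + gap k) ^ n / 4)"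
    using g0 by (intro mult_left_mono) auto
  also have "\<dots> \<le> (\<integral>X. loss k \<theta> X \<partial>sample_law n (dens \<theta>))
      + (\<integral>X. loss k (insert k \<theta>) X \<partial>sample_law n (dens (insert k \<theta>)))"
    unfolding chi_square_gap(2)[OF k \<theta>, symmetric]
  proof (rule two_point_bound[OF prob_density_dens prob_density_dens _ chi_square_gap(1)[OF k \<theta>]])
    show "0 < dens \<theta> x" for x using dens_bounds(1)[of \<theta> x] by linarith
  qed (use loss_nonneg loss_le_1 loss_pair g0 k \<theta> in auto)
  finally show ?thesis by simp
qed

lemma risk_lower_bound:
  fixes g :: real
  assumes g: "\<And>k. k \<in> grid m \<Longrightarrow> g \<le> gap k"
  shows "\<exists>\<theta>. m ^ CARD('d) * g / 1152 \<le> JS_risk n q (dens \<theta>)"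
proof -
  \<comment> \<open>The average over the hypercube halves the pairwise bound, so 1152 = 2 *
    576.\<close>
  have "\<exists>\<theta>\<subseteq>grid m. card (grid m :: ('d \<Rightarrow> nat) set) * (g / 576 / 2)
      \<le> (\<Sum>k\<in>grid m. \<integral>X. loss k \<theta> X \<partial>sample_law n (dens \<theta>))"
  proof (rule hypercube_average[OF finite_grid])
    fix k :: "'d \<Rightarrow> nat" and \<theta> assume k: "k \<in> grid m" and \<theta>: "\<theta> \<subseteq> grid m - {k}"
    have "g / 576 \<le> gap k / 576" using g[OF k] by simp
    also note expected_loss_pair[OF k \<theta>]
    finally show "g / 576 \<le> (\<integral>X. loss k \<theta> X \<partial>sample_law n (dens \<theta>))
      + (\<integral>X. loss k (insert k \<theta>) X \<partial>sample_law n (dens (insert k \<theta>)))" .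
  qed
  then show ?thesis
    using sum_loss_le_risk by (fastforce simp: card_grid intro: order_trans)
qed

end

section \<open>Choice of the parameters\<close>

text \<open>
  The amplitude is tied to \<open>m ^ d / n\<close> instead of \<open>m powr (- \<beta>)\<close>: rounding \<open>r\<close> up to the integer
  \<open>m\<close> then costs a factor depending on \<open>\<beta>\<close> only in the Hoelder norm, not in the risk.
\<close>

lemma holder_constant_bound:
  fixes r \<beta> :: real
  assumes r: "1 \<le> r" "r \<le> m" "m \<le> 2 * r" and n: "n = r powr (2 * \<beta> + real d)"
    and a: "0 \<le> a" and \<beta>: "0 < \<beta>"
  shows "a * sqrt (m ^ d / n) \<le> a * 2 ^ d" "a * sqrt (m ^ d / n) * m powr \<beta> \<le> a * 2 ^ d * 2 powr \<beta>"
    "r powr (- 2 * \<beta>) \<le> m ^ d / n"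
proof -
  have n0: "0 < n" using r n by simp
  have rd: "r ^ d / n = r powr (- 2 * \<beta>)"
    using r by (simp add: n powr_add powr_minus powr_realpow field_simps)
  have "r ^ d / n \<le> m ^ d / n"
    using r n0 by (intro divide_right_mono power_mono) auto
  then show "r powr (- 2 * \<beta>) \<le> m ^ d / n" by (simp add: rd)
  have "m ^ d / n \<le> (2 * r) ^ d / n"
    using r n0 by (intro divide_right_mono power_mono) auto
  also have "\<dots> = 2 ^ d * r powr (- 2 * \<beta>)"
    unfolding rd[symmetric] by (simp add: power_mult_distrib)
  \<comment> \<open>Enlarging \<open>2 ^ d\<close> to its square makes the square root
    explicit.\<close>
  also have "\<dots> \<le> (2 ^ d * r powr (- \<beta>))\<^sup>2"
  proof -
    have "(2::real) ^ d * 1 \<le> 2 ^ d * 2 ^ d" by (intro mult_left_mono) auto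
    then have "(2::real) ^ d * r powr (- 2 * \<beta>) \<le> (2 ^ d * 2 ^ d) * r powr (- 2 * \<beta>)"
      by (intro mult_right_mono) auto
    also have "\<dots> = (2 ^ d * r powr (- \<beta>))\<^sup>2"
      by (simp add: power2_eq_square mult_ac flip: powr_add)
    finally show ?thesis .
  qed
  finally have s: "sqrt (m ^ d / n) \<le> 2 ^ d * r powr (- \<beta>)"
    by (intro real_le_lsqrt) auto
  have "r powr (- \<beta>) \<le> 1" using r \<beta> by (simp add: powr_minus ge_one_powr_ge_zero inverse_le_1_iff)
  then have "2 ^ d * r powr (- \<beta>) \<le> 2 ^ d * 1" by (intro mult_left_mono) auto
  with s have "sqrt (m ^ d / n) \<le> 2 ^ d" by linarith
  then show "a * sqrt (m ^ d / n) \<le> a * 2 ^ d" using a by (intro mult_left_mono)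
  have "sqrt (m ^ d / n) * m powr \<beta> \<le> (2 ^ d * r powr (- \<beta>)) * (2 * r) powr \<beta>"
    using r \<beta> s by (intro mult_mono powr_mono2) auto
  also have "\<dots> = 2 ^ d * 2 powr \<beta>"
    using r by (simp add: powr_mult powr_minus)
  finally have "a * (sqrt (m ^ d / n) * m powr \<beta>) \<le> a * (2 ^ d * 2 powr \<beta>)"
    using a by (intro mult_left_mono)
  then show "a * sqrt (m ^ d / n) * m powr \<beta> \<le> a * 2 ^ d * 2 powr \<beta>"
    by (simp add: mult_ac)
qed

theorem theorem3:
  shows "\<exists>c>0. \<forall>\<beta>>2. \<exists>H>0. \<exists>\<Lambda>>1. \<forall>n\<ge>1.
    \<forall>q :: (nat \<Rightarrow> real^'d::finite) \<Rightarrow> real^'d \<Rightarrow> real. density_estimate n q \<longrightarrow>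
      ereal (c * real n powr (- (2 * \<beta>) / (2 * \<beta> + real CARD('d))))
        \<le> (SUP p \<in> density_class \<beta> H \<Lambda>. ereal (JS_risk n q p))"
proof -
  \<comment> \<open>Any fixed coordinate will do; it is chosen once, before \<open>\<beta>\<close>,
    because its energy enters \<open>c\<close>.\<close>
  define e where "e = (undefined :: 'd)"
  define E where "E = energy e"
  define C where "C = CARD('d) * bump_bound 1 ^ CARD('d)"
  have E: "0 < E" unfolding E_def by (rule energy_pos)
  have C: "0 < C" unfolding C_def using bump_bound_ge_1[of 1] by (simp add: zero_less_mult_iff)
  \<comment> \<open>The first entry yields \<open>C * A \<le> 1 / 2\<close>, because
    \<open>A \<le> a * 2 ^ d\<close>; the second yields
    \<open>n * gap k \<le> 2 * a^2 * E \<le> 1\<close>.\<close>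
  define a where "a = min (1 / (2 * C * 2 ^ CARD('d))) (sqrt (1 / (2 * E)))"
  have a: "0 < a" using C E by (simp add: a_def)
  have aC: "C * (a * 2 ^ CARD('d)) \<le> 1 / 2"
  proof -
    have "a \<le> 1 / (2 * C * 2 ^ CARD('d))" by (simp add: a_def)
    then show ?thesis using C by (simp add: field_simps)
  qed
  have aE: "2 * (a\<^sup>2 * E) \<le> 1"
  proof -
    have "a\<^sup>2 \<le> (sqrt (1 / (2 * E)))\<^sup>2" using a by (intro power_mono) (auto simp: a_def)
    then have "a\<^sup>2 \<le> 1 / (2 * E)" using E by simp
    then show ?thesis using E by (simp add: field_simps)
  qed
  \<comment> \<open>The factor 2/3 of the lower gap bound and the 1152 of the risk bound combine to
    1728.\<close>
  define c where "c = a\<^sup>2 * E / 1728"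
  have c: "0 < c" using a E by (simp add: c_def)
  have main: "\<exists>H>0. \<exists>\<Lambda>>1. \<forall>n\<ge>1. \<forall>q :: (nat \<Rightarrow> real^'d) \<Rightarrow> real^'d \<Rightarrow> real. density_estimate n q \<longrightarrow>
      ereal (c * real n powr (- (2 * \<beta>) / (2 * \<beta> + real CARD('d))))
        \<le> (SUP p \<in> density_class \<beta> H \<Lambda>. ereal (JS_risk n q p))"
    if \<beta>: "2 < \<beta>" for \<beta> :: real
  proof -
    define B where "B = bump_bound (Suc (holder_order (1 + \<beta>))) ^ CARD('d)"
    \<comment> \<open>The Hoelder bound of the shift, with \<open>A * m powr \<beta>\<close>
      replaced by its upper bound that is uniform in \<open>n\<close>.\<close>
    define H where "H = 1 + 2 * CARD('d) * B * (a * 2 ^ CARD('d) * 2 powr \<beta>)"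
    have B: "0 \<le> B" unfolding B_def using bump_bound_ge_1 by (intro zero_le_power) (meson order_trans zero_le_one)
    have H: "0 < H" unfolding H_def using a B by (intro add_pos_nonneg) auto
    have "ereal (c * real n powr (- (2 * \<beta>) / (2 * \<beta> + real CARD('d))))
        \<le> (SUP p \<in> density_class \<beta> H 2. ereal (JS_risk n q p))"
      if n: "1 \<le> n" and q: "density_estimate n q" for n and q :: "(nat \<Rightarrow> real^'d) \<Rightarrow> real^'d \<Rightarrow> real"
    proof -
      define r where "r = real n powr (1 / (2 * \<beta> + real CARD('d)))"
      \<comment> \<open>As \<open>r\<close> is at least 1, rounding up at most doubles it.\<close>
      define m where "m = nat \<lceil>r\<rceil>"
      have r1: "1 \<le> r" unfolding r_def using n \<beta> by (intro ge_one_powr_ge_zero) auto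
      have rm: "r \<le> m" "m \<le> 2 * r" unfolding m_def using r1 by linarith+
      have m: "0 < m" using rm r1 by linarith
      have nr: "real n = r powr (2 * \<beta> + real CARD('d))"
        using n \<beta> by (simp add: r_def powr_powr)
      have rate: "r powr (- 2 * \<beta>) = real n powr (- (2 * \<beta>) / (2 * \<beta> + real CARD('d)))"
        by (simp add: r_def powr_powr)
      define A where "A = a * sqrt (m ^ CARD('d) / n)"
      note bound = holder_constant_bound[OF r1 rm nr less_imp_le[OF a], folded A_def]
      have A0: "0 \<le> A" using a by (simp add: A_def)
      have "C * A \<le> C * (a * 2 ^ CARD('d))"
        using bound(1) \<beta> C by (intro mult_left_mono) (auto simp: A_def)
      with aC have "C * A \<le> 1 / 2" by linarith
      then have "CARD('d) * bump_bound 1 ^ CARD('d) * A \<le> 1 / 2"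
        by (simp only: C_def of_nat_mult of_nat_power)
      then interpret shift_map m A e
        by unfold_locales (use m A0 in auto)
      \<comment> \<open>With this amplitude the factors \<open>m ^ d\<close> cancel exactly, so the
        gap is of order \<open>1 / n\<close> whatever the rounding.\<close>
      have AE: "A\<^sup>2 * energy e / m ^ CARD('d) = a\<^sup>2 * E / n"
        using m n by (simp add: A_def E_def power_mult_distrib)
      have "n * gap k \<le> 1" if "k \<in> grid m" for k
      proof -
        have "n * gap k \<le> n * (2 * (a\<^sup>2 * E / n))"
          using gap_bounds(2)[OF that] unfolding AE by (intro mult_left_mono) auto
        also have "\<dots> = 2 * (a\<^sup>2 * E)" using n by simp
        finally show ?thesis using aE by linarith
      qed
      then interpret shift_estimation m A e n q
        by unfold_locales (use q in auto)
      have "\<exists>\<theta>. m ^ CARD('d) * (2 / 3 * (a\<^sup>2 * E / n)) / 1152 \<le> JS_risk n q (dens \<theta>)"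
      proof (rule risk_lower_bound)
        show "2 / 3 * (a\<^sup>2 * E / n) \<le> gap k" if "k \<in> grid m" for k
          using gap_bounds(1)[OF that] unfolding AE .
      qed
      then obtain \<theta> where \<theta>: "m ^ CARD('d) * (2 / 3 * (a\<^sup>2 * E / n)) / 1152 \<le> JS_risk n q (dens \<theta>)"
        by blast
      have "c * r powr (- 2 * \<beta>) \<le> c * (m ^ CARD('d) / n)"
        using bound(3) \<beta> c by (intro mult_left_mono) auto
      also have "\<dots> = m ^ CARD('d) * (2 / 3 * (a\<^sup>2 * E / n)) / 1152"
        by (simp add: c_def)
      finally have "c * r powr (- 2 * \<beta>) \<le> JS_risk n q (dens \<theta>)" using \<theta> by linarith
      moreover have "dens \<theta> \<in> density_class \<beta> H 2"
      proof (rule dens_in_class[OF \<beta>])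
        have "A * m powr \<beta> \<le> a * 2 ^ CARD('d) * 2 powr \<beta>"
          using bound(2) \<beta> by (simp add: A_def)
        then show "1 + 2 * CARD('d) * bump_bound (Suc (holder_order (1 + \<beta>))) ^ CARD('d) * (A * m powr \<beta>) \<le> H"
          unfolding H_def B_def[symmetric] using B by (intro add_left_mono mult_left_mono) auto
      qed
      ultimately show ?thesis
        unfolding rate[symmetric] by (intro SUP_upper2[of "dens \<theta>"]) auto
    qed
    then show ?thesis by (intro exI[of _ H] conjI H exI[of _ "2::real"]) auto
  qed
  then show ?thesis using c by blast
qed

end
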